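(* Let $d=1$ and $\Lambda=[0,1]$, and let $\varphi$ be a zero mean complex Gaussian field on $[0,1]$ with $\mathbb{E}[\varphi(x)\varphi(y)]=0$ and $\mathbb{E}[\varphi(x)\varphi(y)^*]=C(x,y)$, given by its Karhunen-Loève expansion $\varphi(x)=\sum_{n\ge 1}s_n\sqrt{\mu_n}\,\phi_n(x)$ as described in the context. Let $T_C$ be the covariance operator on $L^2([0,1])$ with kernel $C$, and let $\kappa_1>0$ be its largest eigenvalue. Let $\hat\varphi=\varphi/\|\varphi\|_2$, and let $\hat\varphi_\bot$ be the component of $\hat\varphi$ orthogonal in $L^2([0,1])$ to the eigenspace of $T_C$ associated with $\kappa_1$. If the fourth order partial derivative $\frac{\partial^4}{\partial x^4}C(x,y)$ exists and is continuous on $[0,1]^2$, then $\varphi$ is almost surely continuous on $[0,1]$, the function $x\mapsto\langle x|T_C^{1/2}|x\rangle=\sum_{n\ge1}\sqrt{\mu_n}\,|\phi_n(x)|^2$ is bounded on $[0,1]$, and consequently $$\lim_{r\to+\infty}\mathbb{E}\left(\|\hat\varphi_\bot\|_\infty\;\middle|\;\|\varphi\|_2^2>r\right)=0.$$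
   Context: $\|\cdot\|_2$ is the norm of $L^2([0,1])$ (complex-valued functions, Lebesgue measure) and $\|f\|_\infty=\sup_{x\in[0,1]}|f(x)|$. The covariance operator is $(T_Cf)(x)=\int_0^1 C(x,y)f(y)\,dy$ for $f\in L^2([0,1])$; it is a nonnegative self-adjoint operator, assumed nonzero. Its eigenvalues, counted with multiplicity, are $\mu_1\ge\mu_2\ge\cdots\ge 0$ with $\mu_n\to0$, with corresponding orthonormal eigenfunctions $\phi_n$; for $\mu_n>0$ the function $\phi_n$ is defined at every point by $\phi_n(x)=\mu_n^{-1}\int_0^1 C(x,y)\phi_n(y)\,dy$ (terms with $\mu_n=0$ contribute zero to all series). The distinct values taken by the $\mu_n$ are $\kappa_1>\kappa_2>\cdots$, so that $\kappa_1=\mu_1>0$. The variables $s_1,s_2,\dots$ are i.i.d. complex Gaussian (circularly symmetric) with $\mathbb{E}[s_n]=0$, $\mathbb{E}[s_ns_m]=0$, $\mathbb{E}[s_n^*s_m]=\delta_{nm}$. The field $\varphi$ is identified with the sum of its Karhunen-Loève series $\varphi(x)=\sum_{n\ge1}s_n\sqrt{\mu_n}\,\phi_n(x)$. $\mathbb{P}$ is the law of the field and $\mathbb{E}$ the corresponding expectation. Letting $g_1$ be the (finite) multiplicity of $\kappa_1$, the projection onto the $\kappa_1$-eigenspace is $\varphi_\parallel=\sum_{n\le g_1}s_n\sqrt{\mu_n}\,\phi_n$, and $\varphi_\bot=\varphi-\varphi_\parallel$, $\hat\varphi_\bot=\varphi_\bot/\|\varphi\|_2$. *)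

theory Defs
  imports "HOL-Probability.Probability"
begin

abbreviation lebesgue01 :: "real measure" where
  "lebesgue01 \<equiv> lebesgue_on {0..1}"

definition L2 :: "(real \<Rightarrow> complex) \<Rightarrow> bool" where
  "L2 f \<longleftrightarrow> f \<in> borel_measurable lebesgue01 \<and> integrable lebesgue01 (\<lambda>x. (norm (f x))\<^sup>2)"

definition L2_inner :: "(real \<Rightarrow> complex) \<Rightarrow> (real \<Rightarrow> complex) \<Rightarrow> complex" where
  "L2_inner f g = (LINT x|lebesgue01. cnj (f x) * g x)"

definition L2_norm :: "(real \<Rightarrow> complex) \<Rightarrow> real" where
  "L2_norm f = sqrt (LINT x|lebesgue01. (norm (f x))\<^sup>2)"

(* A genuine pointwise supremum, valued in ennreal so that it is infinite for unbounded f. *)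
definition sup_norm :: "(real \<Rightarrow> complex) \<Rightarrow> ennreal" where
  "sup_norm f = (SUP x\<in>{0..1}. ennreal (norm (f x)))"

definition cov_op :: "(real \<Rightarrow> real \<Rightarrow> complex) \<Rightarrow> (real \<Rightarrow> complex) \<Rightarrow> real \<Rightarrow> complex" where
  "cov_op C f x = (LINT y|lebesgue01. C x y * f y)"

(* Elements of L^2 are represented by functions, so identities in L^2 hold almost everywhere. *)
definition eigenspace :: "(real \<Rightarrow> real \<Rightarrow> complex) \<Rightarrow> real \<Rightarrow> (real \<Rightarrow> complex) set" where
  "eigenspace C \<kappa> =
     {f. L2 f \<and> (AE x in lebesgue01. cov_op C f x = complex_of_real \<kappa> * f x)}"

definition is_eigenvalue :: "(real \<Rightarrow> real \<Rightarrow> complex) \<Rightarrow> real \<Rightarrow> bool" where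
  "is_eigenvalue C \<kappa> \<longleftrightarrow> (\<exists>f\<in>eigenspace C \<kappa>. \<not> (AE x in lebesgue01. f x = 0))"

definition is_largest_eigenvalue :: "(real \<Rightarrow> real \<Rightarrow> complex) \<Rightarrow> real \<Rightarrow> bool" where
  "is_largest_eigenvalue C \<kappa> \<longleftrightarrow>
     is_eigenvalue C \<kappa> \<and> (\<forall>\<nu>. is_eigenvalue C \<nu> \<longrightarrow> \<nu> \<le> \<kappa>)"

(* The eigenvalues, indexed from 0, in decreasing order and padded with zeros if the rank is
   finite.  Only the e n with \<mu> n > 0 are constrained; these are defined pointwise through the
   kernel.  The last clause says that every positive eigenvalue occurs with its full
   multiplicity: the e n with \<mu> n = \<kappa> span the eigenspace of \<kappa>. *)
definition eigensystem ::
  "(real \<Rightarrow> real \<Rightarrow> complex) \<Rightarrow> (nat \<Rightarrow> real) \<Rightarrow> (nat \<Rightarrow> real \<Rightarrow> complex) \<Rightarrow> bool" where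
  "eigensystem C \<mu> e \<longleftrightarrow>
     decseq \<mu> \<and> (\<forall>n. 0 \<le> \<mu> n) \<and> \<mu> \<longlonglongrightarrow> 0 \<and>
     (\<forall>n. 0 < \<mu> n \<longrightarrow> L2 (e n)) \<and>
     (\<forall>m n. 0 < \<mu> m \<longrightarrow> 0 < \<mu> n \<longrightarrow> L2_inner (e m) (e n) = (if m = n then 1 else 0)) \<and>
     (\<forall>n. 0 < \<mu> n \<longrightarrow>
        (\<forall>x\<in>{0..1}. e n x = complex_of_real (inverse (\<mu> n)) * cov_op C (e n) x)) \<and>
     (\<forall>\<kappa>>0. \<forall>f\<in>eigenspace C \<kappa>. \<exists>c :: nat \<Rightarrow> complex.
        AE x in lebesgue01. f x = (\<Sum>n | \<mu> n = \<kappa>. c n * e n x))"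

(* One-sided derivatives at the end points of the interval. *)
definition C4_in_first_variable :: "(real \<Rightarrow> real \<Rightarrow> complex) \<Rightarrow> bool" where
  "C4_in_first_variable C \<longleftrightarrow>
     (\<exists>D :: nat \<Rightarrow> real \<Rightarrow> real \<Rightarrow> complex.
        (\<forall>x\<in>{0..1}. \<forall>y\<in>{0..1}. D 0 x y = C x y) \<and>
        (\<forall>k<4. \<forall>x\<in>{0..1}. \<forall>y\<in>{0..1}.
           ((\<lambda>t. D k t y) has_vector_derivative D (Suc k) x y) (at x within {0..1})) \<and>
        continuous_on ({0..1} \<times> {0..1}) (\<lambda>(x, y). D 4 x y))"

(* Point masses count as (degenerate) Gaussian. *)
definition real_gaussian :: "'a measure \<Rightarrow> ('a \<Rightarrow> real) \<Rightarrow> bool" where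
  "real_gaussian M X \<longleftrightarrow> X \<in> borel_measurable M \<and>
     ((\<exists>m. AE \<omega> in M. X \<omega> = m) \<or>
      (\<exists>m. \<exists>\<sigma>>0. distributed M lborel X (\<lambda>x. ennreal (normal_density m \<sigma> x))))"

(* Joint Gaussianity of the real and imaginary parts: with complex coefficients a, the real
   parts below are exactly the real linear combinations of all Re (X _ x) and Im (X _ x). *)
definition complex_gaussian_field :: "'a measure \<Rightarrow> ('a \<Rightarrow> real \<Rightarrow> complex) \<Rightarrow> bool" where
  "complex_gaussian_field M X \<longleftrightarrow>
     (\<forall>x\<in>{0..1}. (\<lambda>\<omega>. X \<omega> x) \<in> borel_measurable M) \<and>
     (\<forall>F a. finite F \<and> F \<subseteq> {0..1} \<longrightarrow> real_gaussian M (\<lambda>\<omega>. Re (\<Sum>x\<in>F. a x * X \<omega> x)))"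

(* The circularly symmetric complex Gaussian law with E[z] = 0, E[z z] = 0, E[cnj z * z] = 1,
   i.e. independent N(0,1/2) real and imaginary parts. *)
definition std_complex_gaussian :: "'a measure \<Rightarrow> ('a \<Rightarrow> complex) \<Rightarrow> bool" where
  "std_complex_gaussian M X \<longleftrightarrow>
     distributed M lborel X (\<lambda>z. ennreal (exp (- (norm z)\<^sup>2) / pi))"

definition KL_term ::
  "(nat \<Rightarrow> 'a \<Rightarrow> complex) \<Rightarrow> (nat \<Rightarrow> real) \<Rightarrow> (nat \<Rightarrow> real \<Rightarrow> complex) \<Rightarrow> nat \<Rightarrow> 'a \<Rightarrow> real \<Rightarrow> complex"
where
  "KL_term s \<mu> e n \<omega> x = s n \<omega> * complex_of_real (sqrt (\<mu> n)) * e n x"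

(* The field minus its projection onto the \<kappa>-eigenspace when \<kappa> is the top eigenvalue \<mu> 0;
   card {n. \<mu> n = \<kappa>} is then the multiplicity of \<kappa>. *)
definition perp_part ::
  "(nat \<Rightarrow> 'a \<Rightarrow> complex) \<Rightarrow> (nat \<Rightarrow> real) \<Rightarrow> (nat \<Rightarrow> real \<Rightarrow> complex) \<Rightarrow> real \<Rightarrow>
   ('a \<Rightarrow> real \<Rightarrow> complex) \<Rightarrow> 'a \<Rightarrow> real \<Rightarrow> complex"
where
  "perp_part s \<mu> e \<kappa> \<phi> \<omega> x = \<phi> \<omega> x - (\<Sum>n < card {n. \<mu> n = \<kappa>}. KL_term s \<mu> e n \<omega> x)"

(* Conditional expectation of a nonnegative random variable given an event. *)
definition expectation_given :: "'a measure \<Rightarrow> ('a \<Rightarrow> ennreal) \<Rightarrow> ('a \<Rightarrow> bool) \<Rightarrow> ennreal" where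
  "expectation_given M X P = (\<integral>\<^sup>+ \<omega>. X \<omega> \<partial>uniform_measure M {\<omega> \<in> space M. P \<omega>})"

end

(* Since C is Hermitian and has four continuous derivatives in x, interpolating x by piecewise
   cubics on N intervals approximates C by a kernel of rank 4N up to O(N^-4) in sup norm, whence
   mu_n = O(n^(-9/2)).  Fourth differences of e_n, averaged over steps up to a multiple of
   mu_n^(1/4), give sup |e_n|^2 = O(mu_n^(-1/4)).  So sqrt(mu_n) sup |e_n|^2 = O(mu_n^(1/4)) is
   summable, which yields the boundedness statement and makes the Karhunen-Loeve series converge
   uniformly almost surely.

   For the limit let U and V be the parts of |phi|_2^2 carried by the top eigenvalue kappa and by
   the others.  The law of |s_0|^2 is exponential, so P(U > r - v) <= exp(v / kappa) P(U > r), and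
   the sup norm Y of the perpendicular part satisfies
   E[Y; U + V > r] <= E[Y exp(V / kappa)] P(U > r).  The expectation on the right is finite
   because all other eigenvalues lie below kappa.  Hence the conditional expectation is
   O(r^(-1/2)). *)

theory Submission
  imports Defs
begin

section \<open>Cubic interpolation\<close>

text \<open>The exponents leave little room. Approximating C in sup norm alone would only guarantee
  mu_n = O(n^(-4)), and the fourth roots of that bound form a harmonic series. The missing n^(-1/2)
  comes from measuring the error in the Hilbert-Schmidt manner: Bessel's inequality bounds the
  squared errors of all eigenfunctions together, so about n eigenvalues share one budget of order
  N^(-8). This gives mu_n^(1/4) = O(n^(-9/8)). Smoothness is given in x only, and C is not assumed
  jointly continuous; Hermitian symmetry and interpolation supply continuity in y and boundedness.
  Interpolation and fourth differences are two instances of one estimate for four weights that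
  reproduce cubics. The law of U is never computed. Only the exponential law of |s_0|^2 is used, and
  the other top modes shift its threshold randomly. Since P(U > r) <= P(U + V > r), dividing by the
  probability of the conditioning event leaves a constant independent of r.\<close>

lemma taylor_remainder_bound:
  fixes D :: "nat \<Rightarrow> real \<Rightarrow> complex"
  assumes der: "\<And>k t. k < m \<Longrightarrow> t \<in> S \<Longrightarrow> (D k has_vector_derivative D (Suc k) t) (at t within S)"
    and bnd: "\<And>t. t \<in> S \<Longrightarrow> norm (D m t) \<le> K"
    and S: "convex S" "x \<in> S" "z \<in> S"
  shows "norm (D 0 z - (\<Sum>k<m. of_real ((z - x) ^ k / fact k) * D k x)) \<le> K * \<bar>z - x\<bar> ^ m"
  using der bnd S(3)
proof (induction m arbitrary: D z)
  case 0
  then show ?case using S by simp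
next
  case (Suc m)
  define E where "E t = D 0 t - (\<Sum>k<Suc m. of_real ((t - x) ^ k / fact k) * D k x)" for t
  \<comment> \<open>The derivative in \<open>t\<close> of the remainder of order
    \<open>Suc m\<close> is the remainder of order \<open>m\<close> for the shifted family
    \<open>D \<circ> Suc\<close>, so the induction hypothesis and the mean value inequality suffice.
    The gain of a factorial is given up.\<close>
  define E' where "E' t = D 1 t - (\<Sum>k<m. of_real ((t - x) ^ k / fact k) * D (Suc k) x)" for t
  have K0: "0 \<le> K" using Suc.prems(2)[OF S(2)] norm_ge_zero order_trans by blast
  have dE: "(E has_vector_derivative E' t) (at t within S)" if t: "t \<in> S" for t
  proof -
    have "((\<lambda>t. of_real ((t - x) ^ Suc k / fact (Suc k)) * D (Suc k) x) has_vector_derivative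
        of_real ((t - x) ^ k / fact k) * D (Suc k) x) (at t within S)" for k
    proof -
      have "((\<lambda>t. (t - x) ^ Suc k / fact (Suc k)) has_real_derivative (t - x) ^ k / fact k) (at t within S)"
        by (auto intro!: derivative_eq_intros simp del: power_Suc)
      then show ?thesis
        by (intro has_vector_derivative_mult_left has_vector_derivative_of_real)
    qed
    then have "((\<lambda>t. D 0 t - (D 0 x + (\<Sum>k<m. of_real ((t - x) ^ Suc k / fact (Suc k)) * D (Suc k) x)))
       has_vector_derivative D (Suc 0) t - (0 + (\<Sum>k<m. of_real ((t - x) ^ k / fact k) * D (Suc k) x))) (at t within S)"
      using Suc.prems(1)[of 0, OF _ t]
      by (intro has_vector_derivative_diff has_vector_derivative_add has_vector_derivative_const has_vector_derivative_sum) auto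
    then show ?thesis unfolding E_def E'_def
      by (simp add: sum.lessThan_Suc_shift del: power_Suc sum.lessThan_Suc)
  qed
  have E'b: "norm (E' t) \<le> K * \<bar>t - x\<bar> ^ m" if "t \<in> S" for t
  proof -
    have "norm ((D \<circ> Suc) 0 t - (\<Sum>k<m. of_real ((t - x) ^ k / fact k) * (D \<circ> Suc) k x)) \<le> K * \<bar>t - x\<bar> ^ m"
      by (rule Suc.IH) (use Suc.prems S that in auto)
    then show ?thesis by (simp add: E'_def)
  qed
  have seg: "closed_segment x z \<subseteq> S" using S(1,2) Suc.prems(3) by (simp add: closed_segment_subset)
  have "norm (E z - E x) \<le> (K * \<bar>z - x\<bar> ^ m) * norm (z - x)"
  proof (rule differentiable_bound[where f = E and f' = "\<lambda>t h. h *\<^sub>R E' t" and S = "closed_segment x z"])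
    show "(E has_derivative (\<lambda>h. h *\<^sub>R E' t)) (at t within closed_segment x z)" if "t \<in> closed_segment x z" for t
      using dE[of t] that seg has_derivative_subset unfolding has_vector_derivative_def by blast
    show "onorm (\<lambda>h. h *\<^sub>R E' t) \<le> K * \<bar>z - x\<bar> ^ m" if t: "t \<in> closed_segment x z" for t
    proof (rule onorm_le)
      fix h :: real
      have "norm (E' t) \<le> K * \<bar>z - x\<bar> ^ m"
        using E'b[of t] t seg K0
        by (smt (verit) mult_left_mono power_mono closed_segment_eq_real_ivl atLeastAtMost_iff subsetD abs_ge_zero)
      then show "norm (h *\<^sub>R E' t) \<le> K * \<bar>z - x\<bar> ^ m * norm h"
        by (simp add: mult.commute mult_left_mono)
    qed
  qed auto
  moreover have "E x = 0" by (simp add: E_def sum.lessThan_Suc_shift del: sum.lessThan_Suc)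
  ultimately show ?case by (simp add: E_def mult_ac)
qed

text \<open>Weights that reproduce cubics at \<open>x\<close> combine the Taylor polynomials at the
  four nodes into \<open>D 0 x\<close>, and only the four remainders survive. The weights may be
  negative and \<open>x\<close> may lie outside the range of the nodes, so this covers interpolation
  and extrapolation alike.\<close>

lemma cubic_quadrature_error:
  fixes D :: "nat \<Rightarrow> real \<Rightarrow> complex" and w z :: "nat \<Rightarrow> real"
  assumes der: "\<And>k t. k < 4 \<Longrightarrow> t \<in> {0..1} \<Longrightarrow> (D k has_vector_derivative D (Suc k) t) (at t within {0..1})"
    and bnd: "\<And>t. t \<in> {0..1} \<Longrightarrow> norm (D 4 t) \<le> K"
    and x: "x \<in> {0..1}" and z: "\<And>j. j < 4 \<Longrightarrow> z j \<in> {0..1}"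
    and exact: "\<And>k. k < 4 \<Longrightarrow> (\<Sum>j<4. w j * (z j - x) ^ k) = (if k = 0 then 1 else 0)"
    and w: "\<And>j. j < 4 \<Longrightarrow> \<bar>w j\<bar> \<le> A" and h: "\<And>j. j < 4 \<Longrightarrow> \<bar>z j - x\<bar> \<le> h"
  shows "norm (D 0 x - (\<Sum>j<4. of_real (w j) * D 0 (z j))) \<le> 4 * A * K * h ^ 4"
proof -
  have K0: "0 \<le> K" using bnd[OF x] norm_ge_zero order_trans by blast
  define R where "R j = D 0 (z j) - (\<Sum>k<4. of_real ((z j - x) ^ k / fact k) * D k x)" for j
  have R: "norm (R j) \<le> K * h ^ 4" if "j < 4" for j
  proof -
    have "norm (R j) \<le> K * \<bar>z j - x\<bar> ^ 4"
      unfolding R_def by (rule taylor_remainder_bound[where S = "{0..1}"]) (use der bnd x z that in auto)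
    also have "\<dots> \<le> K * h ^ 4" using h[OF that] K0 by (intro mult_left_mono power_mono) auto
    finally show ?thesis .
  qed
  have "(\<Sum>j<4. of_real (w j) * (\<Sum>k<4. of_real ((z j - x) ^ k / fact k) * D k x))
      = (\<Sum>k<4. of_real (\<Sum>j<4. w j * (z j - x) ^ k) * D k x / fact k)"
    unfolding of_real_sum sum_distrib_left sum_distrib_right sum_divide_distrib
    by (subst sum.swap) (simp add: mult_ac)
  also have "\<dots> = (\<Sum>k<(4::nat). if k = 0 then D 0 x else 0)"
    by (intro sum.cong) (auto simp: exact)
  also have "\<dots> = D 0 x" by simp
  finally have "D 0 x - (\<Sum>j<4. of_real (w j) * D 0 (z j)) = - (\<Sum>j<4. of_real (w j) * R j)"
    by (simp add: R_def algebra_simps sum_subtractf)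
  then have "norm (D 0 x - (\<Sum>j<4. of_real (w j) * D 0 (z j))) = norm (\<Sum>j<4. of_real (w j) * R j)"
    by simp
  also have "\<dots> \<le> (\<Sum>j<(4::nat). A * (K * h ^ 4))"
  proof (rule sum_norm_le)
    fix j :: nat assume "j \<in> {..<4}"
    then show "norm (of_real (w j) * R j) \<le> A * (K * h ^ 4)"
      using R[of j] w[of j] K0 abs_ge_zero[of "w j"] by (auto simp: norm_mult intro!: mult_mono)
  qed
  finally show ?thesis by simp
qed

lemma sum_lessThan_4: "(\<Sum>j<4. f j) = f 0 + f 1 + f 2 + (f (3::nat) :: 'a::comm_monoid_add)"
  by (simp add: numeral_eq_Suc add.assoc)

lemma all_less_4: "(\<forall>k<4. P k) \<longleftrightarrow> P 0 \<and> P 1 \<and> P 2 \<and> P (3::nat)"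
  by (auto simp: numeral_eq_Suc less_Suc_eq)

text \<open>These are the Lagrange basis cubics for the nodes 0, 1, 2, 3, evaluated at the rescaled
  position \<open>\<theta>\<close> of \<open>x\<close>. The crude bound 27 is 3 * 3 * 3, each factor
  being a difference of two points of [0, 3].\<close>

lemma cubic_interpolation_weights:
  fixes a h x :: real
  assumes h: "0 < h" and x: "a \<le> x" "x \<le> a + h"
  obtains w :: "nat \<Rightarrow> real" where
    "\<And>k. k < 4 \<Longrightarrow> (\<Sum>j<4. w j * (a + real j * h / 3 - x) ^ k) = (if k = 0 then 1 else 0)"
    "\<And>j. j < 4 \<Longrightarrow> \<bar>w j\<bar> \<le> 27"
proof -
  define \<theta> where "\<theta> = 3 * (x - a) / h"
  have \<theta>: "0 \<le> \<theta>" "\<theta> \<le> 3" using assms by (auto simp: \<theta>_def field_simps)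
  have xe: "x = a + \<theta> * h / 3" using h by (simp add: \<theta>_def field_simps)
  define w :: "nat \<Rightarrow> real" where
    "w j = (if j = 0 then - (\<theta> - 1) * (\<theta> - 2) * (\<theta> - 3) / 6
            else if j = 1 then \<theta> * (\<theta> - 2) * (\<theta> - 3) / 2
            else if j = 2 then - \<theta> * (\<theta> - 1) * (\<theta> - 3) / 2
            else \<theta> * (\<theta> - 1) * (\<theta> - 2) / 6)" for j
  have b: "\<bar>p * q * r / c\<bar> \<le> 27" if "\<bar>p\<bar> \<le> 3" "\<bar>q\<bar> \<le> 3" "\<bar>r\<bar> \<le> 3" "1 \<le> c" for p q r c :: real
  proof -
    have "\<bar>p * q * r / c\<bar> = \<bar>p\<bar> * \<bar>q\<bar> * \<bar>r\<bar> / c" using that by (simp add: abs_mult)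
    also have "\<dots> \<le> \<bar>p\<bar> * \<bar>q\<bar> * \<bar>r\<bar>" using that divide_left_mono[of 1 c "\<bar>p\<bar> * \<bar>q\<bar> * \<bar>r\<bar>"] by simp
    also have "\<dots> \<le> 3 * 3 * 3" using that by (intro mult_mono) auto
    finally show ?thesis by simp
  qed
  show ?thesis
  proof
    show "\<bar>w j\<bar> \<le> 27" if "j < 4" for j
      unfolding w_def using \<theta> by (auto intro!: b simp del: abs_divide)
    have ex: "\<forall>k<4. (\<Sum>j<4. w j * (real j - \<theta>) ^ k) = (if k = 0 then 1 else 0)"
      unfolding all_less_4 sum_lessThan_4
      by (simp add: w_def power2_eq_square power3_eq_cube) (simp add: field_simps)
    show "(\<Sum>j<4. w j * (a + real j * h / 3 - x) ^ k) = (if k = 0 then 1 else 0)" if "k < 4" for k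
    proof -
      have "(a + real j * h / 3 - x) = (h / 3) * (real j - \<theta>)" for j by (simp add: xe algebra_simps diff_divide_distrib)
      then have "(\<Sum>j<4. w j * (a + real j * h / 3 - x) ^ k) = (h / 3) ^ k * (\<Sum>j<4. w j * (real j - \<theta>) ^ k)"
        unfolding power_mult_distrib sum_distrib_left by (simp only: mult.left_commute power_mult_distrib)
      then show ?thesis using ex that by simp
    qed
  qed
qed

section \<open>Orthonormal systems in L2\<close>

lemma borel_measurable_cnj:
  "f \<in> borel_measurable M \<Longrightarrow> (\<lambda>x. cnj (f x)) \<in> borel_measurable M"
  by (rule measurable_compose[OF _ borel_measurable_continuous_onI]) (auto intro: continuous_on_cnj continuous_on_id)

lemma L2_cnj: "L2 f \<Longrightarrow> L2 (\<lambda>x. cnj (f x))"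
  unfolding L2_def by (auto intro: borel_measurable_cnj)

lemma L2_scale: "L2 f \<Longrightarrow> L2 (\<lambda>x. c * f x)"
  unfolding L2_def by (auto simp: norm_mult power_mult_distrib)

lemma L2_inner_integrable:
  assumes "L2 f" "L2 g"
  shows "integrable lebesgue01 (\<lambda>x. cnj (f x) * g x)"
proof (rule Bochner_Integration.integrable_bound)
  show "integrable lebesgue01 (\<lambda>x. (norm (f x))\<^sup>2 + (norm (g x))\<^sup>2)"
    using assms by (auto simp: L2_def)
  show "(\<lambda>x. cnj (f x) * g x) \<in> borel_measurable lebesgue01"
    using assms by (auto simp: L2_def intro!: borel_measurable_times borel_measurable_cnj)
  have "a * b \<le> a\<^sup>2 + b\<^sup>2" if "0 \<le> a" "0 \<le> b" for a b :: real
    using sum_squares_bound[of a b] mult_nonneg_nonneg[OF that] by linarith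
  then show "AE x in lebesgue01. norm (cnj (f x) * g x) \<le> norm ((norm (f x))\<^sup>2 + (norm (g x))\<^sup>2)"
    by (simp add: norm_mult)
qed

lemma L2_add:
  assumes "L2 f" "L2 g"
  shows "L2 (\<lambda>x. f x + g x)"
  unfolding L2_def
proof
  show m: "(\<lambda>x. f x + g x) \<in> borel_measurable lebesgue01"
    using assms by (auto simp: L2_def)
  show "integrable lebesgue01 (\<lambda>x. (norm (f x + g x))\<^sup>2)"
  proof (rule Bochner_Integration.integrable_bound)
    show "integrable lebesgue01 (\<lambda>x. 2 * (norm (f x))\<^sup>2 + 2 * (norm (g x))\<^sup>2)"
      using assms by (auto simp: L2_def)
    show "(\<lambda>x. (norm (f x + g x))\<^sup>2) \<in> borel_measurable lebesgue01"
      using m by measurable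
    have "(norm (f x + g x))\<^sup>2 \<le> 2 * (norm (f x))\<^sup>2 + 2 * (norm (g x))\<^sup>2" for x
      using power_mono[OF norm_triangle_ineq[of "f x" "g x"], of 2] sum_squares_bound[of "norm (f x)" "norm (g x)"]
      by (simp add: power2_sum)
    then show "AE x in lebesgue01. norm ((norm (f x + g x))\<^sup>2) \<le> norm (2 * (norm (f x))\<^sup>2 + 2 * (norm (g x))\<^sup>2)"
      by simp
  qed
qed

lemma L2_sum:
  assumes "\<And>n. n \<in> I \<Longrightarrow> L2 (f n)"
  shows "L2 (\<lambda>x. \<Sum>n\<in>I. f n x)"
  using assms
proof (induction I rule: infinite_finite_induct)
  case (insert n I)
  then show ?case by (simp add: L2_add)
qed (auto simp: L2_def)

lemma L2_bounded:
  assumes "f \<in> borel_measurable lebesgue01" "\<And>x. x \<in> {0..1} \<Longrightarrow> norm (f x) \<le> B"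
  shows "L2 f"
  unfolding L2_def
proof
  interpret finite_measure lebesgue01 by (rule finite_measure_lebesgue_on) auto
  show "integrable lebesgue01 (\<lambda>x. (norm (f x))\<^sup>2)"
    by (rule integrable_const_bound[where B = "B\<^sup>2"]) (use assms in \<open>auto intro!: AE_I2 power_mono\<close>)
qed fact

lemma L2_norm_sq: "L2 f \<Longrightarrow> (LINT x|lebesgue01. (norm (f x))\<^sup>2) = (L2_norm f)\<^sup>2"
  unfolding L2_norm_def by (simp add: integral_nonneg_AE)

lemma L2_norm_le:
  assumes f: "f \<in> borel_measurable lebesgue01" and B: "\<And>x. x \<in> {0..1} \<Longrightarrow> norm (f x) \<le> B"
  shows "(L2_norm f)\<^sup>2 \<le> B\<^sup>2"
proof -
  interpret finite_measure lebesgue01 by (rule finite_measure_lebesgue_on) auto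
  have L: "L2 f" by (rule L2_bounded) fact+
  have "(L2_norm f)\<^sup>2 \<le> (LINT x|lebesgue01. B\<^sup>2)"
    unfolding L2_norm_sq[OF L, symmetric] using L B
    by (intro integral_mono) (auto simp: L2_def intro!: power_mono)
  also have "\<dots> = B\<^sup>2" by (simp add: measure_restrict_space)
  finally show ?thesis .
qed

lemma L2_inner_self: "L2 f \<Longrightarrow> L2_inner f f = of_real ((L2_norm f)\<^sup>2)"
proof -
  assume f: "L2 f"
  have "cnj (f x) * f x = of_real ((norm (f x))\<^sup>2)" for x
    unfolding complex_norm_square by (rule mult.commute)
  then show ?thesis
    unfolding L2_inner_def L2_norm_sq[OF f, symmetric] by (simp only: integral_complex_of_real)
qed

lemma L2_inner_cnj: "cnj (L2_inner f g) = L2_inner g f"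
proof -
  have "cnj (L2_inner f g) = (LINT x|lebesgue01. cnj (cnj (f x) * g x))"
    unfolding L2_inner_def by (rule Bochner_Integration.integral_cnj[symmetric])
  then show ?thesis by (simp add: L2_inner_def mult.commute)
qed

lemma L2_inner_scale_right: "L2_inner f (\<lambda>x. c * g x) = c * L2_inner f g"
  unfolding L2_inner_def by (simp add: mult.left_commute)

lemma L2_inner_add_right:
  "L2 f \<Longrightarrow> L2 g \<Longrightarrow> L2 h \<Longrightarrow> L2_inner f (\<lambda>x. g x + h x) = L2_inner f g + L2_inner f h"
  unfolding L2_inner_def by (simp add: distrib_left L2_inner_integrable)

lemma L2_inner_sum_right:
  assumes "L2 f" "\<And>n. n \<in> I \<Longrightarrow> L2 (g n)"
  shows "L2_inner f (\<lambda>x. \<Sum>n\<in>I. g n x) = (\<Sum>n\<in>I. L2_inner f (g n))"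
  unfolding L2_inner_def using assms
  by (simp add: sum_distrib_left L2_inner_integrable Bochner_Integration.integral_sum)

lemma L2_inner_sum_left:
  assumes "L2 f" "\<And>n. n \<in> I \<Longrightarrow> L2 (g n)"
  shows "L2_inner (\<lambda>x. \<Sum>n\<in>I. g n x) f = (\<Sum>n\<in>I. L2_inner (g n) f)"
proof -
  have "cnj (L2_inner f (\<lambda>x. \<Sum>n\<in>I. g n x)) = (\<Sum>n\<in>I. cnj (L2_inner f (g n)))"
    using assms by (subst L2_inner_sum_right) auto
  then show ?thesis by (simp only: L2_inner_cnj)
qed

lemma L2_inner_scale_left: "L2_inner (\<lambda>x. c * g x) f = cnj c * L2_inner g f"
  using arg_cong[OF L2_inner_scale_right[of f c g], of cnj] by (simp only: L2_inner_cnj complex_cnj_mult)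

lemma L2_inner_add_left:
  "L2 f \<Longrightarrow> L2 g \<Longrightarrow> L2 h \<Longrightarrow> L2_inner (\<lambda>x. g x + h x) f = L2_inner g f + L2_inner h f"
  using arg_cong[OF L2_inner_add_right[of f g h], of cnj] by (simp only: L2_inner_cnj complex_cnj_add)

text \<open>Finite families suffice, since infinite expansions are reached through partial sums. A
  free index set allows restriction to the indices with \<open>0 < \<mu> n\<close>, the only ones
  where \<open>e n\<close> is constrained.\<close>

definition orthonormal_on :: "nat set \<Rightarrow> (nat \<Rightarrow> real \<Rightarrow> complex) \<Rightarrow> bool" where
  "orthonormal_on I e \<longleftrightarrow> finite I \<and> (\<forall>n\<in>I. L2 (e n)) \<and>
     (\<forall>m\<in>I. \<forall>n\<in>I. L2_inner (e m) (e n) = (if m = n then 1 else 0))"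

lemma pythagoras:
  assumes "orthonormal_on I e"
  shows "(L2_norm (\<lambda>x. \<Sum>n\<in>I. c n * e n x))\<^sup>2 = (\<Sum>n\<in>I. (norm (c n))\<^sup>2)"
proof -
  have L: "\<And>n. n \<in> I \<Longrightarrow> L2 (\<lambda>x. c n * e n x)" and fin: "finite I"
    and Le: "\<And>n. n \<in> I \<Longrightarrow> L2 (e n)"
    using assms by (auto simp: orthonormal_on_def L2_scale)
  have LS: "L2 (\<lambda>x. \<Sum>n\<in>I. c n * e n x)" using L by (rule L2_sum)
  have "of_real ((L2_norm (\<lambda>x. \<Sum>n\<in>I. c n * e n x))\<^sup>2) = (\<Sum>m\<in>I. \<Sum>n\<in>I. cnj (c m) * (c n * L2_inner (e m) (e n)))"
    using LS L Le unfolding L2_inner_self[OF LS, symmetric]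
    by (simp add: L2_inner_sum_left L2_inner_sum_right L2_inner_scale_left L2_inner_scale_right sum_distrib_left)
  also have "\<dots> = (\<Sum>m\<in>I. \<Sum>n\<in>I. if n = m then cnj (c m) * c m else 0)"
    using assms by (intro sum.cong refl) (auto simp: orthonormal_on_def)
  also have "\<dots> = of_real (\<Sum>m\<in>I. (norm (c m))\<^sup>2)"
    using fin by (simp add: sum.delta complex_norm_square mult.commute del: of_real_power)
  finally show ?thesis by (simp only: of_real_eq_iff)
qed

text \<open>The coefficients \<open>c n\<close> carry a minus sign, so \<open>f x + p x\<close> is
  the residual of the orthogonal projection; its squared norm is nonnegative.\<close>

lemma bessel:
  assumes e: "orthonormal_on I e" and f: "L2 f"
  shows "(\<Sum>n\<in>I. (norm (L2_inner (e n) f))\<^sup>2) \<le> (L2_norm f)\<^sup>2"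
proof -
  define c where "c n = - L2_inner (e n) f" for n
  define p where "p x = (\<Sum>n\<in>I. c n * e n x)" for x
  have L: "\<And>n. n \<in> I \<Longrightarrow> L2 (\<lambda>x. c n * e n x)" and fin: "finite I" and Le: "\<And>n. n \<in> I \<Longrightarrow> L2 (e n)"
    using e by (auto simp: orthonormal_on_def L2_scale)
  have Lp: "L2 p" unfolding p_def using L by (rule L2_sum)
  let ?s = "\<Sum>n\<in>I. (norm (L2_inner (e n) f))\<^sup>2"
  have pf: "L2_inner p f = - of_real ?s"
  proof -
    have "L2_inner p f = (\<Sum>n\<in>I. cnj (c n) * L2_inner (e n) f)"
      using f L unfolding p_def by (simp add: L2_inner_sum_left L2_inner_scale_left)
    then show ?thesis by (simp add: c_def complex_norm_square sum_negf mult.commute del: of_real_power)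
  qed
  then have fp: "L2_inner f p = - of_real ?s"
    using L2_inner_cnj[of p f] by (simp del: of_real_power of_real_sum)
  have pp: "L2_inner p p = of_real ?s"
    unfolding L2_inner_self[OF Lp] unfolding p_def pythagoras[OF e] by (simp add: c_def)
  have "of_real ((L2_norm (\<lambda>x. f x + p x))\<^sup>2) = L2_inner (\<lambda>x. f x + p x) (\<lambda>x. f x + p x)"
    using L2_inner_self[OF L2_add[OF f Lp]] by simp
  also have "\<dots> = L2_inner f f + L2_inner f p + (L2_inner p f + L2_inner p p)"
    using f Lp L2_add[OF f Lp] by (simp add: L2_inner_add_right L2_inner_add_left)
  also have "\<dots> = of_real ((L2_norm f)\<^sup>2 - ?s)"
    by (simp add: pf fp pp L2_inner_self[OF f] del: of_real_power of_real_sum)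
  finally have "(L2_norm (\<lambda>x. f x + p x))\<^sup>2 = (L2_norm f)\<^sup>2 - ?s" by (simp only: of_real_eq_iff)
  then show ?thesis by (smt (verit) zero_le_power2)
qed

section \<open>Orthonormal systems of coordinate vectors\<close>

text \<open>Gram-Schmidt in the coordinate space over \<open>J\<close>. Dependent vectors are
  skipped, so \<open>q\<close> can be smaller than \<open>r\<close>; only the upper bound on
  \<open>q\<close> matters later, as a bound on a rank.\<close>

lemma gram_schmidt_coordinates:
  fixes a :: "nat \<Rightarrow> 'b \<Rightarrow> complex"
  assumes J: "finite J"
  shows "\<exists>q\<le>r. \<exists>u. (\<forall>i<q. \<forall>j<q. (\<Sum>n\<in>J. cnj (u i n) * u j n) = (if i = j then 1 else 0)) \<and>
     (\<forall>k<r. \<exists>d. \<forall>n\<in>J. a k n = (\<Sum>i<q. d i * u i n))"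
proof (induction r)
  case 0
  then show ?case by auto
next
  case (Suc r)
  then obtain q u where q: "q \<le> r"
    and orth: "\<And>i j. i < q \<Longrightarrow> j < q \<Longrightarrow> (\<Sum>n\<in>J. cnj (u i n) * u j n) = (if i = j then 1 else 0)"
    and span: "\<And>k. k < r \<Longrightarrow> \<exists>d. \<forall>n\<in>J. a k n = (\<Sum>i<q. d i * u i n)"
    by blast
  define c where "c i = (\<Sum>n\<in>J. cnj (u i n) * a r n)" for i
  define v where "v n = a r n - (\<Sum>i<q. c i * u i n)" for n
  have uv: "(\<Sum>n\<in>J. cnj (u i n) * v n) = 0" if "i < q" for i
  proof -
    have "(\<Sum>n\<in>J. cnj (u i n) * v n) = c i - (\<Sum>n\<in>J. \<Sum>j<q. c j * (cnj (u i n) * u j n))"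
      by (simp add: v_def c_def algebra_simps sum_subtractf sum_distrib_left)
    also have "(\<Sum>n\<in>J. \<Sum>j<q. c j * (cnj (u i n) * u j n)) = (\<Sum>j<q. c j * (\<Sum>n\<in>J. cnj (u i n) * u j n))"
      by (subst sum.swap) (simp add: sum_distrib_left)
    also have "\<dots> = (\<Sum>j<q. if j = i then c i else 0)"
      by (intro sum.cong refl) (auto simp: orth that)
    also have "\<dots> = c i" using that by simp
    finally show ?thesis by simp
  qed
  define s where "s = (\<Sum>n\<in>J. (norm (v n))\<^sup>2)"
  have s0: "0 \<le> s" by (simp add: s_def sum_nonneg)
  show ?case
  proof (cases "s = 0")
    case True
    then have "v n = 0" if "n \<in> J" for n
      using that J by (simp add: s_def sum_nonneg_eq_0_iff)
    then have "\<forall>n\<in>J. a r n = (\<Sum>i<q. c i * u i n)" by (auto simp: v_def)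
    then show ?thesis using q orth span
      by (intro exI[of _ q] conjI exI[of _ u]) (auto simp: less_Suc_eq)
  next
    case False
    define w where "w n = v n / of_real (sqrt s)" for n
    define u' where "u' i = (if i = q then w else u i)" for i
    have uw: "(\<Sum>n\<in>J. cnj (u i n) * w n) = 0" if "i < q" for i
      using uv[OF that] by (simp add: w_def flip: sum_divide_distrib)
    have wu: "(\<Sum>n\<in>J. cnj (w n) * u i n) = 0" if "i < q" for i
      using arg_cong[OF uw[OF that], of cnj] by (simp add: mult.commute)
    have ww: "(\<Sum>n\<in>J. cnj (w n) * w n) = 1"
    proof -
      have "cnj (w n) * w n = of_real ((norm (v n))\<^sup>2) / of_real s" for n
      proof -
        have "cnj (w n) * w n = cnj (v n) * v n / of_real (sqrt s * sqrt s)"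
          unfolding w_def of_real_mult by (simp del: of_real_mult real_sqrt_mult_self)
        then show ?thesis using s0 by (simp add: complex_norm_square mult.commute del: of_real_power)
      qed
      then show ?thesis using False by (simp flip: sum_divide_distrib of_real_sum s_def of_real_power)
    qed
    have orth': "(\<Sum>n\<in>J. cnj (u' i n) * u' j n) = (if i = j then 1 else 0)" if "i < Suc q" "j < Suc q" for i j
      using that orth uw wu ww by (auto simp: u'_def less_Suc_eq)
    have span': "\<exists>d. \<forall>n\<in>J. a k n = (\<Sum>i<Suc q. d i * u' i n)" if k: "k < Suc r" for k
    proof (cases "k = r")
      case True
      show ?thesis
        by (rule exI[of _ "\<lambda>i. if i = q then of_real (sqrt s) else c i"])
          (use False s0 True in \<open>auto simp: u'_def w_def v_def\<close>)
    next
      case k': False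
      then obtain d where "\<forall>n\<in>J. a k n = (\<Sum>i<q. d i * u i n)" using span k by force
      then show ?thesis
        by (intro exI[of _ "\<lambda>i. if i = q then 0 else d i"]) (auto simp: u'_def)
    qed
    show ?thesis
      by (rule exI[of _ "Suc q"]) (use q orth' span' in blast)
  qed
qed

lemma orthonormal_combination_norm:
  fixes u :: "nat \<Rightarrow> 'b \<Rightarrow> complex"
  assumes orth: "\<And>i j. i < q \<Longrightarrow> j < q \<Longrightarrow> (\<Sum>n\<in>J. cnj (u i n) * u j n) = (if i = j then 1 else 0)"
  shows "(\<Sum>n\<in>J. (\<Sum>i<q. d i * u i n) * cnj (\<Sum>i<q. d i * u i n)) = (\<Sum>i<q. d i * cnj (d i))"
proof -
  define p where "p n = (\<Sum>i<q. d i * u i n)" for n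
  have "(\<Sum>n\<in>J. p n * cnj (p n)) = (\<Sum>i<q. \<Sum>j<q. d j * cnj (d i) * (\<Sum>n\<in>J. cnj (u i n) * u j n))"
  proof -
    have "(\<Sum>n\<in>J. p n * cnj (p n)) = (\<Sum>n\<in>J. \<Sum>i<q. \<Sum>j<q. d j * cnj (d i) * (cnj (u i n) * u j n))"
      unfolding p_def cnj_sum sum_product by (subst sum.swap) (simp add: mult_ac)
    also have "\<dots> = (\<Sum>i<q. \<Sum>n\<in>J. \<Sum>j<q. d j * cnj (d i) * (cnj (u i n) * u j n))"
      by (rule sum.swap)
    also have "\<dots> = (\<Sum>i<q. \<Sum>j<q. \<Sum>n\<in>J. d j * cnj (d i) * (cnj (u i n) * u j n))"
      by (intro sum.cong refl sum.swap)
    finally show ?thesis by (simp add: sum_distrib_left)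
  qed
  also have "\<dots> = (\<Sum>i<q. \<Sum>j<q. if j = i then d i * cnj (d i) else 0)"
    by (intro sum.cong refl) (auto simp: orth)
  finally show ?thesis unfolding p_def by simp
qed

text \<open>The squared norm of \<open>v\<close> is the squared distance to the span plus the
  squared norm of the projection, and no combination \<open>d\<close> does better than that
  distance. The freedom in \<open>d\<close> lets an explicit interpolant replace the
  projection.\<close>

lemma best_approximation:
  fixes u :: "nat \<Rightarrow> 'b \<Rightarrow> complex"
  assumes orth: "\<And>i j. i < q \<Longrightarrow> j < q \<Longrightarrow> (\<Sum>n\<in>J. cnj (u i n) * u j n) = (if i = j then 1 else 0)"
  shows "(\<Sum>n\<in>J. (norm (v n))\<^sup>2) \<le> (\<Sum>n\<in>J. (norm (v n - (\<Sum>i<q. d i * u i n)))\<^sup>2) +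
     (\<Sum>i<q. (norm (\<Sum>n\<in>J. cnj (u i n) * v n))\<^sup>2)"
proof -
  define c where "c i = (\<Sum>n\<in>J. cnj (u i n) * v n)" for i
  define p where "p n = (\<Sum>i<q. d i * u i n)" for n
  have vp: "(\<Sum>n\<in>J. v n * cnj (p n)) = (\<Sum>i<q. cnj (d i) * c i)"
    unfolding p_def c_def cnj_sum sum_distrib_left by (subst sum.swap) (simp add: mult_ac)
  then have pv: "(\<Sum>n\<in>J. p n * cnj (v n)) = (\<Sum>i<q. d i * cnj (c i))"
  proof -
    have "(\<Sum>n\<in>J. p n * cnj (v n)) = cnj (\<Sum>n\<in>J. v n * cnj (p n))" by (simp add: mult.commute)
    then show ?thesis by (simp add: vp)
  qed
  have pp: "(\<Sum>n\<in>J. p n * cnj (p n)) = (\<Sum>i<q. d i * cnj (d i))"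
    unfolding p_def by (rule orthonormal_combination_norm) (rule orth)
  have "of_real (\<Sum>n\<in>J. (norm (v n - p n))\<^sup>2) = (\<Sum>n\<in>J. (v n - p n) * cnj (v n - p n))"
    by (simp add: complex_norm_square del: of_real_power)
  also have "\<dots> = (\<Sum>n\<in>J. v n * cnj (v n)) - (\<Sum>n\<in>J. v n * cnj (p n)) - (\<Sum>n\<in>J. p n * cnj (v n)) + (\<Sum>n\<in>J. p n * cnj (p n))"
    by (simp add: algebra_simps sum.distrib sum_subtractf)
  \<comment> \<open>Completing the square around the optimal coefficients
    \<open>c i\<close>.\<close>
  also have "\<dots> = (\<Sum>n\<in>J. v n * cnj (v n)) - (\<Sum>i<q. c i * cnj (c i)) + (\<Sum>i<q. (c i - d i) * cnj (c i - d i))"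
    unfolding vp pv pp by (simp add: algebra_simps sum.distrib sum_subtractf)
  also have "\<dots> = of_real ((\<Sum>n\<in>J. (norm (v n))\<^sup>2) - (\<Sum>i<q. (norm (c i))\<^sup>2) + (\<Sum>i<q. (norm (c i - d i))\<^sup>2))"
    by (simp add: complex_norm_square del: of_real_power)
  finally have "(\<Sum>n\<in>J. (norm (v n - p n))\<^sup>2) =
    (\<Sum>n\<in>J. (norm (v n))\<^sup>2) - (\<Sum>i<q. (norm (c i))\<^sup>2) + (\<Sum>i<q. (norm (c i - d i))\<^sup>2)"
    by (simp only: of_real_eq_iff)
  moreover have "0 \<le> (\<Sum>i<q. (norm (c i - d i))\<^sup>2)" by (simp add: sum_nonneg)
  ultimately show ?thesis by (simp add: c_def p_def)
qed

text \<open>The sum \<open>S\<close> is the squared norm of the projection \<open>p\<close> of the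
  unit vector with coordinate \<open>k\<close>, and also the value \<open>p k\<close>. Hence
  \<open>S\<^sup>2 \<le> S\<close>.\<close>

lemma orthonormal_coordinate_mass:
  fixes u :: "nat \<Rightarrow> 'b \<Rightarrow> complex"
  assumes J: "finite J" "k \<in> J"
    and orth: "\<And>i j. i < q \<Longrightarrow> j < q \<Longrightarrow> (\<Sum>n\<in>J. cnj (u i n) * u j n) = (if i = j then 1 else 0)"
  shows "(\<Sum>i<q. (norm (u i k))\<^sup>2) \<le> 1"
proof -
  define S where "S = (\<Sum>i<q. (norm (u i k))\<^sup>2)"
  define p where "p n = (\<Sum>i<q. cnj (u i k) * u i n)" for n
  have pk: "p k = of_real S"
    by (simp add: p_def S_def complex_norm_square mult.commute del: of_real_power)
  have "of_real (\<Sum>n\<in>J. (norm (p n))\<^sup>2) = (\<Sum>n\<in>J. p n * cnj (p n))"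
    by (simp add: complex_norm_square del: of_real_power)
  also have "\<dots> = (\<Sum>i<q. cnj (u i k) * cnj (cnj (u i k)))"
    unfolding p_def by (rule orthonormal_combination_norm) (rule orth)
  also have "\<dots> = of_real S"
    by (simp add: S_def complex_norm_square mult.commute del: of_real_power)
  finally have "(\<Sum>n\<in>J. (norm (p n))\<^sup>2) = S" by (simp only: of_real_eq_iff)
  moreover have "(norm (p k))\<^sup>2 \<le> (\<Sum>n\<in>J. (norm (p n))\<^sup>2)"
    using J by (intro member_le_sum) auto
  ultimately have "S\<^sup>2 \<le> S" by (simp add: pk)
  then have "S \<le> 1" by (cases "S \<le> 0") (auto simp: power2_eq_square)
  then show ?thesis by (simp add: S_def)
qed

section \<open>Eigenfunctions of smooth kernels\<close>

text \<open>Change of variables with a Jacobian of at least 1. It bounds the average of a squared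
  eigenfunction along a moving node by its full integral.\<close>

lemma nn_integral_dilation_le:
  fixes f :: "real \<Rightarrow> ennreal"
  assumes f: "f \<in> borel_measurable borel" and c: "1 \<le> \<bar>c\<bar>"
  shows "(\<integral>\<^sup>+ t. f (x + c * t) \<partial>lborel) \<le> (\<integral>\<^sup>+ y. f y \<partial>lborel)"
proof -
  have "1 * (\<integral>\<^sup>+ t. f (x + c * t) \<partial>lborel) \<le> ennreal \<bar>c\<bar> * (\<integral>\<^sup>+ t. f (x + c * t) \<partial>lborel)"
    using c by (intro mult_right_mono) auto
  also have "\<dots> = (\<integral>\<^sup>+ y. f y \<partial>lborel)"
    using f c by (intro nn_integral_real_affine[symmetric]) auto
  finally show ?thesis by simp
qed

text \<open>Smoothness concerns the first variable only; \<open>hermitian\<close> transfers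
  continuity to the second. The bound \<open>K\<close> on the fourth derivative is the only
  quantitative datum about the kernel.\<close>

locale smooth_kernel =
  fixes C :: "real \<Rightarrow> real \<Rightarrow> complex" and D :: "nat \<Rightarrow> real \<Rightarrow> real \<Rightarrow> complex"
    and \<mu> :: "nat \<Rightarrow> real" and e :: "nat \<Rightarrow> real \<Rightarrow> complex" and K :: real
  assumes hermitian: "x \<in> {0..1} \<Longrightarrow> y \<in> {0..1} \<Longrightarrow> C x y = cnj (C y x)"
    and D_0: "x \<in> {0..1} \<Longrightarrow> y \<in> {0..1} \<Longrightarrow> D 0 x y = C x y"
    and D_Suc: "k < 4 \<Longrightarrow> x \<in> {0..1} \<Longrightarrow> y \<in> {0..1} \<Longrightarrow>
      ((\<lambda>t. D k t y) has_vector_derivative D (Suc k) x y) (at x within {0..1})"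
    and D_4: "x \<in> {0..1} \<Longrightarrow> y \<in> {0..1} \<Longrightarrow> norm (D 4 x y) \<le> K"
    and eigen: "eigensystem C \<mu> e"
begin

lemma K_nonneg: "0 \<le> K"
  using order_trans[OF norm_ge_zero D_4[of 0 0]] by simp

lemma mu_nonneg: "0 \<le> \<mu> n" and mu_decseq: "decseq \<mu>" and mu_tendsto: "\<mu> \<longlonglongrightarrow> 0"
  using eigen by (auto simp: eigensystem_def)

lemma e_L2: "0 < \<mu> n \<Longrightarrow> L2 (e n)"
  using eigen by (auto simp: eigensystem_def)

lemma e_orthonormal: "finite I \<Longrightarrow> (\<And>n. n \<in> I \<Longrightarrow> 0 < \<mu> n) \<Longrightarrow> orthonormal_on I e"
  using eigen by (auto simp: eigensystem_def orthonormal_on_def)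

lemma e_cov_op: "0 < \<mu> n \<Longrightarrow> x \<in> {0..1} \<Longrightarrow> of_real (\<mu> n) * e n x = cov_op C (e n) x"
  using eigen by (auto simp: eigensystem_def)

section \<open>Regularity of the kernel and of its eigenfunctions\<close>

lemma continuous_on_fst_section:
  assumes "y \<in> {0..1}"
  shows "continuous_on {0..1} (\<lambda>x. C x y)"
proof -
  have "continuous_on {0..1} (\<lambda>x. D 0 x y)"
    unfolding continuous_on_eq_continuous_within
    by (intro ballI has_vector_derivative_continuous[OF D_Suc]) (use assms in auto)
  then show ?thesis by (rule continuous_on_cong[THEN iffD1, rotated -1]) (use assms in \<open>auto simp: D_0\<close>)
qed

lemma continuous_on_snd_section:
  assumes "x \<in> {0..1}"
  shows "continuous_on {0..1} (C x)"
proof -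
  have "continuous_on {0..1} (\<lambda>y. cnj (C y x))"
    by (intro continuous_intros continuous_on_fst_section assms)
  then show ?thesis by (rule continuous_on_cong[THEN iffD1, rotated -1]) (use assms in \<open>auto simp: hermitian[of x]\<close>)
qed

lemma section_measurable: "x \<in> {0..1} \<Longrightarrow> C x \<in> borel_measurable lebesgue01"
  by (intro continuous_imp_measurable_on_sets_lebesgue continuous_on_snd_section) auto

lemma quadrature_error:
  assumes "x \<in> {0..1}" "y \<in> {0..1}" and z: "\<And>j. j < 4 \<Longrightarrow> z j \<in> {0..1}"
    and "\<And>k. k < 4 \<Longrightarrow> (\<Sum>j<4. w j * (z j - x) ^ k) = (if k = 0 then 1 else 0)"
    and "\<And>j. j < 4 \<Longrightarrow> \<bar>w j\<bar> \<le> A" and "\<And>j. j < 4 \<Longrightarrow> \<bar>z j - x\<bar> \<le> h"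
  shows "norm (C x y - (\<Sum>j<(4::nat). of_real (w j) * C (z j) y)) \<le> 4 * A * K * h ^ 4"
proof -
  have "norm (D 0 x y - (\<Sum>j<(4::nat). of_real (w j) * D 0 (z j) y)) \<le> 4 * A * K * h ^ 4"
    by (rule cubic_quadrature_error[where D = "\<lambda>k t. D k t y"]) (use assms D_Suc D_4 in auto)
  moreover have "(\<Sum>j<(4::nat). of_real (w j) * D 0 (z j) y) = (\<Sum>j<(4::nat). of_real (w j) * C (z j) y)"
    by (intro sum.cong) (use z assms in \<open>auto simp: D_0\<close>)
  ultimately show ?thesis using assms by (simp add: D_0)
qed

text \<open>Separate continuity does not give boundedness. Interpolating the first variable at 0,
  1/3, 2/3, 1 does: up to an error governed by \<open>K\<close>, every section is a combination of
  four fixed continuous sections with weights at most 27 in modulus.\<close>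

lemma kernel_bounded:
  obtains B where "\<And>x y. x \<in> {0..1} \<Longrightarrow> y \<in> {0..1} \<Longrightarrow> norm (C x y) \<le> B"
proof -
  define z :: "nat \<Rightarrow> real" where "z j = 0 + real j * 1 / 3" for j
  have z: "z j \<in> {0..1}" if "j < 4" for j using that by (auto simp: z_def)
  have "\<exists>b. \<forall>y\<in>{0..1}. norm (C (z j) y) \<le> b" if "j < 4" for j
  proof -
    have "bounded (C (z j) ` {0..1})"
      by (intro compact_imp_bounded compact_continuous_image continuous_on_snd_section z that) auto
    then show ?thesis by (auto simp: bounded_iff)
  qed
  then obtain b where b: "\<And>j y. j < 4 \<Longrightarrow> y \<in> {0..1} \<Longrightarrow> norm (C (z j) y) \<le> b j" by metis
  show ?thesis
  proof
    fix x y :: real assume x: "x \<in> {0..1}" and y: "y \<in> {0..1}"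
    obtain w where w: "\<And>k. k < 4 \<Longrightarrow> (\<Sum>j<4. w j * (z j - x) ^ k) = (if k = 0 then 1 else 0)"
      "\<And>j. j < 4 \<Longrightarrow> \<bar>w j\<bar> \<le> 27"
      using cubic_interpolation_weights[of 1 0 x] x unfolding z_def by auto
    have "norm (C x y - (\<Sum>j<(4::nat). of_real (w j) * C (z j) y)) \<le> 4 * 27 * K * 1 ^ 4"
      by (rule quadrature_error) (use x y z w in \<open>force simp: abs_le_iff\<close>)+
    moreover have "norm (\<Sum>j<(4::nat). of_real (w j) * C (z j) y) \<le> (\<Sum>j<4. 27 * b j)"
      using w b y by (intro sum_norm_le) (auto simp: norm_mult intro!: mult_mono)
    ultimately show "norm (C x y) \<le> 108 * K + (\<Sum>j<4. 27 * b j)"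
      using norm_triangle_sub[of "C x y" "\<Sum>j<4. of_real (w j) * C (z j) y"] by simp
  qed
qed

lemma section_L2: "x \<in> {0..1} \<Longrightarrow> L2 (C x)"
  using kernel_bounded section_measurable L2_bounded by metis

text \<open>By the eigenvalue equation each term is the modulus of a Fourier coefficient of a single
  function, the conjugated kernel residual \<open>R\<close>. Bessel's inequality therefore controls
  all \<open>n\<close> in \<open>I\<close> at once, which is stronger than one bound for each
  \<open>n\<close>.\<close>

lemma quadrature_bessel:
  assumes I: "finite I" "\<And>n. n \<in> I \<Longrightarrow> 0 < \<mu> n"
    and x: "x \<in> {0..1}" and z: "\<And>j. j < 4 \<Longrightarrow> z j \<in> {0..1}"
    and w: "\<And>k. k < 4 \<Longrightarrow> (\<Sum>j<4. w j * (z j - x) ^ k) = (if k = 0 then 1 else 0)"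
      "\<And>j. j < 4 \<Longrightarrow> \<bar>w j\<bar> \<le> A" and h: "\<And>j. j < 4 \<Longrightarrow> \<bar>z j - x\<bar> \<le> h"
  shows "(\<Sum>n\<in>I. (norm (of_real (\<mu> n) * e n x - (\<Sum>j<(4::nat). of_real (w j) * (of_real (\<mu> n) * e n (z j)))))\<^sup>2)
     \<le> (4 * A * K * h ^ 4)\<^sup>2"
proof -
  define R where "R y = C x y - (\<Sum>j<(4::nat). of_real (w j) * C (z j) y)" for y
  have Rm: "R \<in> borel_measurable lebesgue01"
    unfolding R_def using section_measurable x z by (intro borel_measurable_diff borel_measurable_sum borel_measurable_times) auto
  have Rb: "norm (R y) \<le> 4 * A * K * h ^ 4" if "y \<in> {0..1}" for y
    unfolding R_def by (rule quadrature_error) (use assms that in auto)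
  have LR: "L2 (\<lambda>y. cnj (R y))" using L2_bounded[OF Rm Rb] by (rule L2_cnj) auto
  have eq: "norm (of_real (\<mu> n) * e n x - (\<Sum>j<(4::nat). of_real (w j) * (of_real (\<mu> n) * e n (z j)))) =
      norm (L2_inner (e n) (\<lambda>y. cnj (R y)))" if n: "n \<in> I" for n
  proof -
    have int: "integrable lebesgue01 (\<lambda>y. C x' y * e n y)" if "x' \<in> {0..1}" for x'
      using L2_inner_integrable[OF L2_cnj[OF section_L2[OF that]] e_L2[OF I(2)[OF n]]] by simp
    have "L2_inner (\<lambda>y. cnj (R y)) (e n) = (LINT y|lebesgue01. C x y * e n y - (\<Sum>j<(4::nat). of_real (w j) * (C (z j) y * e n y)))"
      unfolding L2_inner_def by (simp add: R_def left_diff_distrib sum_distrib_right mult.assoc)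
    also have "\<dots> = cov_op C (e n) x - (\<Sum>j<(4::nat). of_real (w j) * cov_op C (e n) (z j))"
      unfolding cov_op_def using int x z by (subst Bochner_Integration.integral_diff) (auto simp: Bochner_Integration.integral_sum)
    also have "\<dots> = of_real (\<mu> n) * e n x - (\<Sum>j<(4::nat). of_real (w j) * (of_real (\<mu> n) * e n (z j)))"
      using I n x z by (simp add: e_cov_op)
    finally show ?thesis by (metis L2_inner_cnj complex_mod_cnj)
  qed
  have "(\<Sum>n\<in>I. (norm (L2_inner (e n) (\<lambda>y. cnj (R y))))\<^sup>2) \<le> (L2_norm (\<lambda>y. cnj (R y)))\<^sup>2"
    using I LR by (intro bessel e_orthonormal) auto
  also have "\<dots> \<le> (4 * A * K * h ^ 4)\<^sup>2"
    using Rb borel_measurable_cnj[OF Rm] by (intro L2_norm_le) auto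
  finally show ?thesis by (simp add: eq)
qed

text \<open>Continuity is inherited from the integral equation by dominated convergence:
  \<open>C x y\<close> is continuous in \<open>x\<close>, and \<open>B * norm (e n y)\<close> is an
  integrable majorant.\<close>

lemma continuous_on_e:
  assumes n: "0 < \<mu> n"
  shows "continuous_on {0..1} (e n)"
proof -
  obtain B where B: "\<And>x y. x \<in> {0..1} \<Longrightarrow> y \<in> {0..1} \<Longrightarrow> norm (C x y) \<le> B"
    using kernel_bounded by metis
  have em: "e n \<in> borel_measurable lebesgue01" using e_L2[OF n] by (simp add: L2_def)
  have "L2 (\<lambda>x. 1)" by (rule L2_bounded[where B = 1]) auto
  then have eint: "integrable lebesgue01 (e n)"
    using L2_inner_integrable[of "\<lambda>x. 1" "e n"] e_L2[OF n] by simp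
  have "continuous_on {0..1} (cov_op C (e n))"
    unfolding continuous_on_sequentially
  proof (intro ballI allI impI)
    fix X :: "nat \<Rightarrow> real" and a assume a: "a \<in> {0..1}" and X: "(\<forall>i. X i \<in> {0..1}) \<and> X \<longlonglongrightarrow> a"
    have "(\<lambda>i. LINT y|lebesgue01. C (X i) y * e n y) \<longlonglongrightarrow> (LINT y|lebesgue01. C a y * e n y)"
    proof (rule integral_dominated_convergence[where w = "\<lambda>y. B * norm (e n y)"])
      show "(\<lambda>y. C a y * e n y) \<in> borel_measurable lebesgue01"
        "\<And>i. (\<lambda>y. C (X i) y * e n y) \<in> borel_measurable lebesgue01"
        using em a X by (auto intro!: borel_measurable_times section_measurable)
      show "integrable lebesgue01 (\<lambda>y. B * norm (e n y))" using eint by auto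
      show "AE y in lebesgue01. norm (C (X i) y * e n y) \<le> B * norm (e n y)" for i
        using B X by (intro AE_I2) (auto simp: norm_mult intro!: mult_right_mono)
      show "AE y in lebesgue01. (\<lambda>i. C (X i) y * e n y) \<longlonglongrightarrow> C a y * e n y"
      proof (intro AE_I2 tendsto_mult tendsto_const)
        fix y assume "y \<in> space lebesgue01"
        then have "continuous_on {0..1} (\<lambda>x. C x y)" by (intro continuous_on_fst_section) simp
        then show "(\<lambda>i. C (X i) y) \<longlonglongrightarrow> C a y"
          using a X by (auto simp: continuous_on_sequentially o_def)
      qed
    qed
    then show "(cov_op C (e n) \<circ> X) \<longlonglongrightarrow> cov_op C (e n) a" by (simp add: cov_op_def o_def)
  qed
  then have "continuous_on {0..1} (\<lambda>x. of_real (inverse (\<mu> n)) * cov_op C (e n) x)"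
    by (intro continuous_intros)
  then show ?thesis
    by (rule continuous_on_cong[THEN iffD1, rotated -1]) (use n in \<open>auto simp: e_cov_op[symmetric]\<close>)
qed

lemma e_norm: "0 < \<mu> n \<Longrightarrow> (L2_norm (e n))\<^sup>2 = 1"
  using pythagoras[OF e_orthonormal[of "{n}"], of "\<lambda>_. 1"] by simp

section \<open>Decay of the eigenvalues\<close>

text \<open>For every \<open>x\<close> the vector of all \<open>\<mu> m * e m x\<close> with
  \<open>m \<le> n\<close> lies close to the span of the \<open>4 * N\<close> vectors taken at the
  interpolation nodes. Integrated over \<open>x\<close>, the part of the sum of
  \<open>(\<mu> m)\<^sup>2\<close> not captured by this span is at most the squared error, and a
  span of dimension at most \<open>4 * N\<close> leaves a total mass of at least
  \<open>Suc n - 4 * N\<close> uncaptured. The constant 108 is 4 * 27.\<close>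

lemma low_rank_bound:
  assumes N: "0 < N"
  shows "(\<mu> n)\<^sup>2 * (real (Suc n) - 4 * real N) \<le> (108 * K * (1 / real N) ^ 4)\<^sup>2"
proof (cases "\<mu> n = 0")
  case True
  then show ?thesis by simp
next
  case False
  then have pos: "0 < \<mu> n" using mu_nonneg[of n] by simp
  have mono: "\<mu> n \<le> \<mu> m" if "m \<le> n" for m using mu_decseq that by (simp add: decseq_def)
  then have posI: "0 < \<mu> m" if "m \<in> {..n}" for m using pos that by (meson atMost_iff less_le_trans)
  define B where "B = 108 * K * (1 / real N) ^ 4"
  \<comment> \<open>Node \<open>k mod 4\<close> of cell \<open>k div 4\<close>. End points shared by
    neighbouring cells are listed twice, which Gram-Schmidt tolerates.\<close>
  define p where "p k = real (k div 4) / N + real (k mod 4) * (1 / N) / 3" for k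
  define a where "a k m = of_real (\<mu> m) * e m (p k)" for k m
  obtain q u where q: "q \<le> 4 * N"
    and "\<forall>i<q. \<forall>j<q. (\<Sum>m\<le>n. cnj (u i m) * u j m) = (if i = j then 1 else 0)"
    and "\<forall>k<4 * N. \<exists>d. \<forall>m\<in>{..n}. a k m = (\<Sum>i<q. d i * u i m)"
    using gram_schmidt_coordinates[of "{..n}" "4 * N" a] by blast
  then have orth: "\<And>i j. i < q \<Longrightarrow> j < q \<Longrightarrow> (\<Sum>m\<le>n. cnj (u i m) * u j m) = (if i = j then 1 else 0)"
    and span: "\<And>k. k < 4 * N \<Longrightarrow> \<exists>d. \<forall>m\<in>{..n}. a k m = (\<Sum>i<q. d i * u i m)"
    by blast+
  \<comment> \<open>The coordinate along \<open>u i\<close> of the vector at \<open>x\<close>. As a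
    combination of orthonormal eigenfunctions, it has an explicit norm as a function of
    \<open>x\<close>.\<close>
  define \<psi> where "\<psi> i x = (\<Sum>m\<le>n. (cnj (u i m) * of_real (\<mu> m)) * e m x)" for i x
  have pointwise: "(\<Sum>m\<le>n. (\<mu> m)\<^sup>2 * (norm (e m x))\<^sup>2) \<le> B\<^sup>2 + (\<Sum>i<q. (norm (\<psi> i x))\<^sup>2)"
    if x: "x \<in> {0..1}" for x
  proof -
    \<comment> \<open>The \<open>min\<close> assigns \<open>x = 1\<close>, where the floor would be
      \<open>N\<close>, to the last cell.\<close>
    define i where "i = min (N - 1) (nat \<lfloor>x * N\<rfloor>)"
    have i: "i < N" using N by (auto simp: i_def)
    have "real i \<le> x * N" using x by (auto simp: i_def min_def le_nat_iff le_floor_iff nat_le_iff)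
    then have i1: "real i / N \<le> x" using N by (simp add: divide_le_eq)
    have "x * N \<le> real i + 1"
    proof (cases "nat \<lfloor>x * N\<rfloor> \<le> N - 1")
      case True
      then have "i = nat \<lfloor>x * N\<rfloor>" by (simp add: i_def)
      then show ?thesis using x by simp
    next
      case False
      then have "real i + 1 = N" using N by (simp add: i_def of_nat_diff)
      moreover have "x * real N \<le> 1 * real N" using x by (intro mult_right_mono) auto
      ultimately show ?thesis by simp
    qed
    then have i2: "x \<le> real i / N + 1 / N" using N by (simp add: field_simps)
    obtain w where w: "\<And>k. k < 4 \<Longrightarrow> (\<Sum>j<4. w j * (real i / N + real j * (1 / N) / 3 - x) ^ k) = (if k = 0 then 1 else 0)"
      "\<And>j. j < 4 \<Longrightarrow> \<bar>w j\<bar> \<le> 27"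
      using cubic_interpolation_weights[OF _ i1 i2] N by auto
    define z where "z j = real i / N + real j * (1 / N) / 3" for j
    have zp: "z j = p (4 * i + j)" if "j < 4" for j using that by (simp add: z_def p_def)
    have z1: "real i / N \<le> z j" for j using N by (simp add: z_def)
    have z2: "z j \<le> real i / N + 1 / N" if "j < 4" for j
    proof -
      have "real j * (1 / N) / 3 \<le> 3 * (1 / N) / 3"
        using that by (intro divide_right_mono mult_right_mono) auto
      then show ?thesis by (simp add: z_def)
    qed
    have "real i / N + 1 / N \<le> 1" using i N by (simp add: field_simps)
    then have z: "z j \<in> {0..1}" if "j < 4" for j
      using z1[of j] z2[OF that] by (auto intro: order_trans[of 0 "real i / N"])
    have zh: "\<bar>z j - x\<bar> \<le> 1 / N" if "j < 4" for j using z1[of j] z2[OF that] i1 i2 by linarith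
    have "\<exists>d. \<forall>m\<in>{..n}. a (4 * i + j) m = (\<Sum>i<q. d i * u i m)" if "j < 4" for j
      by (rule span) (use i that in linarith)
    then obtain d where d: "\<And>j m. j < 4 \<Longrightarrow> m \<le> n \<Longrightarrow> a (4 * i + j) m = (\<Sum>i<q. d j i * u i m)"
      by (metis atMost_iff)
    \<comment> \<open>The interpolant at \<open>x\<close> combines node vectors and hence the
      \<open>u i\<close>, so it is an admissible competitor in
      \<open>best_approximation\<close>.\<close>
    have comb: "(\<Sum>j<(4::nat). of_real (w j) * (of_real (\<mu> m) * e m (z j))) = (\<Sum>i<q. (\<Sum>j<(4::nat). of_real (w j) * d j i) * u i m)"
      if "m \<le> n" for m
    proof -
      have "(\<Sum>j<(4::nat). of_real (w j) * (of_real (\<mu> m) * e m (z j))) = (\<Sum>j<(4::nat). of_real (w j) * (\<Sum>i<q. d j i * u i m))"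
        using that d by (intro sum.cong) (auto simp: zp a_def)
      also have "\<dots> = (\<Sum>i<q. (\<Sum>j<(4::nat). of_real (w j) * d j i) * u i m)"
        unfolding sum_distrib_left sum_distrib_right by (subst sum.swap) (simp add: mult.assoc)
      finally show ?thesis .
    qed
    have "(\<Sum>m\<le>n. (norm (of_real (\<mu> m) * e m x))\<^sup>2) \<le>
       (\<Sum>m\<le>n. (norm (of_real (\<mu> m) * e m x - (\<Sum>i<q. (\<Sum>j<(4::nat). of_real (w j) * d j i) * u i m)))\<^sup>2) +
       (\<Sum>i<q. (norm (\<Sum>m\<le>n. cnj (u i m) * (of_real (\<mu> m) * e m x)))\<^sup>2)"
      by (rule best_approximation) (rule orth)
    also have "(\<Sum>m\<le>n. (norm (of_real (\<mu> m) * e m x - (\<Sum>i<q. (\<Sum>j<(4::nat). of_real (w j) * d j i) * u i m)))\<^sup>2) =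
       (\<Sum>m\<le>n. (norm (of_real (\<mu> m) * e m x - (\<Sum>j<(4::nat). of_real (w j) * (of_real (\<mu> m) * e m (z j)))))\<^sup>2)"
      by (intro sum.cong refl) (simp add: comb)
    also have "\<dots> \<le> (4 * 27 * K * (1 / real N) ^ 4)\<^sup>2"
      by (rule quadrature_bessel[OF _ posI x z]) (use w zh in \<open>auto simp: z_def\<close>)
    also have "(\<Sum>m\<le>n. (norm (of_real (\<mu> m) * e m x))\<^sup>2) = (\<Sum>m\<le>n. (\<mu> m)\<^sup>2 * (norm (e m x))\<^sup>2)"
      by (simp add: norm_mult power_mult_distrib)
    finally show ?thesis by (simp add: B_def \<psi>_def mult.assoc)
  qed
  have L\<psi>: "L2 (\<psi> i)" for i
    unfolding \<psi>_def using e_L2 posI by (intro L2_sum L2_scale) auto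
  have n\<psi>: "(L2_norm (\<psi> i))\<^sup>2 = (\<Sum>m\<le>n. (norm (u i m))\<^sup>2 * (\<mu> m)\<^sup>2)" for i
    unfolding \<psi>_def by (subst pythagoras[OF e_orthonormal]) (use posI in \<open>auto simp: norm_mult power_mult_distrib\<close>)
  have "(\<Sum>m\<le>n. (\<mu> m)\<^sup>2) = (LINT x|lebesgue01. (\<Sum>m\<le>n. (\<mu> m)\<^sup>2 * (norm (e m x))\<^sup>2))"
    using e_L2 posI e_norm by (subst Bochner_Integration.integral_sum) (auto simp: L2_def L2_norm_sq)
  also have "\<dots> \<le> (LINT x|lebesgue01. B\<^sup>2 + (\<Sum>i<q. (norm (\<psi> i x))\<^sup>2))"
    using e_L2 posI L\<psi> pointwise
    by (intro integral_mono Bochner_Integration.integrable_sum Bochner_Integration.integrable_add) (auto simp: L2_def finite_measure_lebesgue_on finite_measure.integrable_const)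
  also have "\<dots> = B\<^sup>2 + (\<Sum>i<q. (L2_norm (\<psi> i))\<^sup>2)"
    using L\<psi> by (subst Bochner_Integration.integral_add) (auto simp: L2_def L2_norm_sq Bochner_Integration.integral_sum measure_restrict_space finite_measure_lebesgue_on finite_measure.integrable_const)
  also have "(\<Sum>i<q. (L2_norm (\<psi> i))\<^sup>2) = (\<Sum>m\<le>n. (\<mu> m)\<^sup>2 * (\<Sum>i<q. (norm (u i m))\<^sup>2))"
    unfolding n\<psi> by (subst sum.swap) (simp add: sum_distrib_left mult.commute)
  finally have "(\<Sum>m\<le>n. (\<mu> m)\<^sup>2 * (1 - (\<Sum>i<q. (norm (u i m))\<^sup>2))) \<le> B\<^sup>2"
    by (simp add: right_diff_distrib sum_subtractf)
  \<comment> \<open>The factors \<open>1 - ...\<close> are nonnegative by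
    \<open>orthonormal_coordinate_mass\<close>, so every \<open>\<mu> m\<close> may be lowered to
    the smallest one, \<open>\<mu> n\<close>.\<close>
  moreover have "(\<Sum>m\<le>n. (\<mu> n)\<^sup>2 * (1 - (\<Sum>i<q. (norm (u i m))\<^sup>2))) \<le> (\<Sum>m\<le>n. (\<mu> m)\<^sup>2 * (1 - (\<Sum>i<q. (norm (u i m))\<^sup>2)))"
  proof (intro sum_mono mult_right_mono power_mono mono mu_nonneg)
    fix m assume "m \<in> {..n}"
    then show "0 \<le> 1 - (\<Sum>i<q. (norm (u i m))\<^sup>2)"
      using orthonormal_coordinate_mass[of "{..n}" m q u] orth by simp
  qed auto
  moreover have "(\<Sum>m\<le>n. (\<Sum>i<q. (norm (u i m))\<^sup>2)) = q"
  proof -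
    have "(\<Sum>m\<le>n. (norm (u i m))\<^sup>2) = 1" if "i < q" for i
    proof -
      have "of_real (\<Sum>m\<le>n. (norm (u i m))\<^sup>2) = (\<Sum>m\<le>n. cnj (u i m) * u i m)"
        by (simp add: complex_norm_square mult.commute del: of_real_power)
      then have "of_real (\<Sum>m\<le>n. (norm (u i m))\<^sup>2) = complex_of_real 1" using orth[OF that that] by simp
      then show ?thesis by (simp only: of_real_eq_iff)
    qed
    then show ?thesis by (subst sum.swap) simp
  qed
  then have "(\<Sum>m\<le>n. (\<mu> n)\<^sup>2 * (1 - (\<Sum>i<q. (norm (u i m))\<^sup>2))) = (\<mu> n)\<^sup>2 * (real (Suc n) - q)"
    by (simp add: sum_subtractf flip: sum_distrib_left)
  moreover have "(\<mu> n)\<^sup>2 * (real (Suc n) - 4 * real N) \<le> (\<mu> n)\<^sup>2 * (real (Suc n) - q)"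
    using q by (intro mult_left_mono) auto
  ultimately show ?thesis by (simp add: B_def)
qed

text \<open>Taking \<open>N\<close> near \<open>n / 8\<close> in \<open>low_rank_bound\<close> gives
  \<open>(\<mu> n)\<^sup>2\<close> of order n^(-9); the eighth root has exponent 9/8, just above
  1.\<close>

lemma summable_mu_powr: "summable (\<lambda>n. \<mu> n powr (1/4))"
proof -
  \<comment> \<open>The factor \<open>16 ^ 5\<close> exceeds the square root of the
    \<open>16 ^ 9\<close> met below; adding 1 keeps \<open>c\<close> positive even if
    \<open>K\<close> vanishes.\<close>
  define c where "c = (108 * K * 16 ^ 5 + 1)"
  have c: "1 \<le> c" using K_nonneg by (simp add: c_def)
  have "\<mu> n powr (1/4) \<le> c powr (1/4) * real n powr (- (9/8))" if n: "8 \<le> n" for n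
  proof -
    \<comment> \<open>With \<open>8 * N \<le> n\<close>, at least \<open>N\<close> is left of
      \<open>Suc n - 4 * N\<close>; \<open>n \<le> 16 * N\<close> turns powers of \<open>N\<close>
      back into powers of \<open>n\<close>.\<close>
    define N where "N = n div 8"
    have N: "0 < N" "8 * N \<le> n" "n \<le> 16 * N" using n unfolding N_def by presburger+
    have rN: "real n / 16 \<le> N" "8 * real N \<le> n" using N by linarith+
    have "(\<mu> n)\<^sup>2 * real N \<le> (\<mu> n)\<^sup>2 * (real (Suc n) - 4 * real N)"
      using rN by (intro mult_left_mono) auto
    also have "\<dots> \<le> (108 * K * (1 / real N) ^ 4)\<^sup>2" by (rule low_rank_bound) fact
    finally have "(\<mu> n)\<^sup>2 \<le> (108 * K)\<^sup>2 / real N ^ 9"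
      using N by (simp add: field_simps eval_nat_numeral)
    also have "\<dots> \<le> (108 * K)\<^sup>2 / (real n / 16) ^ 9"
      using rN n by (intro divide_left_mono power_mono) auto
    also have "\<dots> = (108 * K)\<^sup>2 * 16 ^ 9 * real n powr (-9)"
    proof -
      have "real n powr (-9) = inverse (real n ^ 9)" using n by (simp add: powr_minus)
      then show ?thesis by (simp add: power_divide field_simps)
    qed
    also have "\<dots> \<le> c\<^sup>2 * real n powr (-9)"
    proof (intro mult_right_mono)
      have "(108 * K)\<^sup>2 * 16 ^ 9 \<le> (108 * K * 16 ^ 5)\<^sup>2"
        by (simp add: power_mult_distrib mult_left_mono)
      also have "\<dots> \<le> c\<^sup>2" using K_nonneg by (intro power_mono) (auto simp: c_def)
      finally show "(108 * K)\<^sup>2 * 16 ^ 9 \<le> c\<^sup>2" .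
    qed auto
    finally have "((\<mu> n)\<^sup>2) powr (1/8) \<le> (c\<^sup>2 * real n powr (-9)) powr (1/8)"
      by (intro powr_mono2) auto
    moreover have "((\<mu> n)\<^sup>2) powr (1/8) = \<mu> n powr (1/4)"
    proof (cases "\<mu> n = 0")
      case False
      then have "0 < \<mu> n" using mu_nonneg[of n] by simp
      then show ?thesis by (simp add: powr_powr flip: powr_numeral)
    qed simp
    moreover have "(c\<^sup>2 * real n powr (-9)) powr (1/8) = c powr (1/4) * real n powr (- (9/8))"
      using c by (simp add: powr_mult powr_powr flip: powr_numeral)
    ultimately show ?thesis by simp
  qed
  then have "\<forall>\<^sub>F n in sequentially. norm (\<mu> n powr (1/4)) \<le> c powr (1/4) * real n powr (- (9/8))"
    by (intro eventually_sequentiallyI[of 8]) simp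
  moreover have "summable (\<lambda>n. c powr (1/4) * real n powr (- (9/8)))"
    by (intro summable_mult) (simp add: summable_real_powr_iff)
  ultimately show ?thesis by (rule summable_comparison_test_ev)
qed

section \<open>Sup norm of the eigenfunctions\<close>

text \<open>Fourth differences vanish on cubics, so the weights 4, -6, 4, -1 extrapolate the value
  at \<open>x\<close> from four equally spaced points. These lie on one side, chosen by
  \<open>\<sigma>\<close>, so \<open>x\<close> may be an end point. Here 24 is 4 * 6 with 6 the
  largest weight, and 288 is 2 * 4 * 6^2.\<close>

lemma e_pointwise_le_fourth_difference:
  assumes n: "0 < \<mu> n" and x: "x \<in> {0..1}" and t: "0 \<le> t" "t \<le> h"
    and \<sigma>: "\<bar>\<sigma>\<bar> = 1" "x + \<sigma> * (4 * t) \<in> {0..1}"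
  shows "(norm (e n x))\<^sup>2 \<le> 2 * (24 * K * (4 * h) ^ 4)\<^sup>2 / (\<mu> n)\<^sup>2 +
    288 * (\<Sum>j<4. (norm (e n (x + (\<sigma> * (1 + real j)) * t)))\<^sup>2)"
proof -
  define z where "z j = x + (\<sigma> * (1 + real j)) * t" for j :: nat
  define w :: "nat \<Rightarrow> real" where "w j = (if j = 0 then 4 else if j = 1 then - 6 else if j = 2 then 4 else - 1)" for j
  have \<sigma>': "\<sigma> = 1 \<or> \<sigma> = -1" using \<sigma> by linarith
  have jt: "0 \<le> (1 + real j) * t" "(1 + real j) * t \<le> 4 * t" if "j < 4" for j
    using that t by (auto intro: mult_right_mono)
  have z: "z j \<in> {0..1}" if "j < 4" for j
    using \<sigma>' \<sigma>(2) x jt[OF that] by (auto simp: z_def mult.assoc)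
  have zh: "\<bar>z j - x\<bar> \<le> 4 * h" if "j < 4" for j
    using \<sigma>' jt[OF that] t by (auto simp: z_def mult.assoc)
  have w6: "\<bar>w j\<bar> \<le> 6" for j by (simp add: w_def)
  have ex: "\<forall>k<4. (\<Sum>j<4. w j * (1 + real j) ^ k) = (if k = 0 then 1 else 0)"
    unfolding all_less_4 sum_lessThan_4 by (simp add: w_def)
  have "(\<Sum>j<4. w j * (z j - x) ^ k) = (if k = 0 then 1 else 0)" if "k < 4" for k
  proof -
    have "(\<Sum>j<4. w j * (z j - x) ^ k) = (\<sigma> * t) ^ k * (\<Sum>j<4. w j * (1 + real j) ^ k)"
      by (simp add: z_def power_mult_distrib sum_distrib_left mult_ac)
    then show ?thesis using ex that by simp
  qed
  note qb = quadrature_bessel[of "{n}" x z w 6 "4 * h", OF _ _ x z this w6 zh]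
  define S where "S = (\<Sum>j<(4::nat). of_real (w j) * e n (z j))"
  have "of_real (\<mu> n) * e n x - (\<Sum>j<(4::nat). of_real (w j) * (of_real (\<mu> n) * e n (z j))) = of_real (\<mu> n) * (e n x - S)"
    by (simp add: S_def right_diff_distrib sum_distrib_left mult_ac)
  then have "(\<mu> n * norm (e n x - S))\<^sup>2 \<le> (24 * K * (4 * h) ^ 4)\<^sup>2"
    using qb n by (simp add: norm_mult)
  then have d: "(norm (e n x - S))\<^sup>2 \<le> (24 * K * (4 * h) ^ 4)\<^sup>2 / (\<mu> n)\<^sup>2"
    using n by (simp add: field_simps)
  have "norm S \<le> (\<Sum>j<4. 6 * norm (e n (z j)))"
    unfolding S_def using w6 by (intro sum_norm_le) (auto simp: norm_mult intro!: mult_right_mono)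
  then have "(norm S)\<^sup>2 \<le> (\<Sum>j<4. 6 * norm (e n (z j)))\<^sup>2"
    by (intro power_mono) auto
  also have "\<dots> \<le> (\<Sum>j<(4::nat). 6\<^sup>2) * (\<Sum>j<4. (norm (e n (z j)))\<^sup>2)"
    by (rule Cauchy_Schwarz_ineq_sum)
  finally have S2: "(norm S)\<^sup>2 \<le> 144 * (\<Sum>j<4. (norm (e n (z j)))\<^sup>2)" by simp
  have "(norm (e n x))\<^sup>2 \<le> (norm (e n x - S) + norm S)\<^sup>2"
    using norm_triangle_sub[of "e n x" S] by (intro power_mono) (auto simp: add.commute)
  also have "\<dots> \<le> 2 * (norm (e n x - S))\<^sup>2 + 2 * (norm S)\<^sup>2"
    using sum_squares_bound[of "norm (e n x - S)" "norm S"] by (simp add: power2_sum)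
  finally show ?thesis using d S2 unfolding z_def by argo
qed

text \<open>Average the pointwise estimate over \<open>t\<close> in [0, h]. The four nodes move at
  speeds 1 to 4, so by the dilation estimate each contributes at most the squared norm of
  \<open>e n\<close>, which is 1; this gives 1152 = 4 * 288 before division by
  \<open>h\<close>.\<close>

lemma e_sup_le:
  assumes n: "0 < \<mu> n" and x: "x \<in> {0..1}" and h: "0 < h" "h \<le> 1/8"
  shows "(norm (e n x))\<^sup>2 \<le> 2 * (24 * K * (4 * h) ^ 4)\<^sup>2 / (\<mu> n)\<^sup>2 + 1152 / h"
proof -
  \<comment> \<open>The nodes move towards the farther end point; since
    \<open>4 * h \<le> 1/2\<close>, they stay in [0, 1].\<close>
  define \<sigma> :: real where "\<sigma> = (if x \<le> 1/2 then 1 else - 1)"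
  \<comment> \<open>Extension by zero to the whole line, where dilations act. Continuity of
    \<open>e n\<close> makes it Borel; being in L2 gives Lebesgue measurability only.\<close>
  define F where "F y = indicator {0..1} y * ennreal ((norm (e n y))\<^sup>2)" for y
  define c where "c = 2 * (24 * K * (4 * h) ^ 4)\<^sup>2 / (\<mu> n)\<^sup>2"
  have c0: "0 \<le> c" by (simp add: c_def)
  have "(\<lambda>y. indicator {0..1} y *\<^sub>R (norm (e n y))\<^sup>2) \<in> borel_measurable borel"
    by (intro borel_measurable_continuous_on_indicator continuous_intros continuous_on_e n) auto
  then have "(\<lambda>y. ennreal (indicator {0..1} y *\<^sub>R (norm (e n y))\<^sup>2)) \<in> borel_measurable borel"
    by measurable
  moreover have "F = (\<lambda>y. ennreal (indicator {0..1} y *\<^sub>R (norm (e n y))\<^sup>2))"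
    by (auto simp: F_def indicator_def)
  ultimately have Fm: "F \<in> borel_measurable borel" by simp
  have "(\<integral>\<^sup>+ y. F y \<partial>lborel) = (\<integral>\<^sup>+ y. F y \<partial>lebesgue)"
    using Fm by (simp add: nn_integral_completion)
  also have "\<dots> = (\<integral>\<^sup>+ y. ennreal ((norm (e n y))\<^sup>2) \<partial>lebesgue01)"
    by (subst nn_integral_restrict_space) (auto simp: F_def[abs_def] mult.commute)
  also have "\<dots> = ennreal (LINT y|lebesgue01. (norm (e n y))\<^sup>2)"
    using e_L2[OF n] by (intro nn_integral_eq_integral) (auto simp: L2_def)
  also have "\<dots> = 1" using L2_norm_sq[OF e_L2[OF n]] e_norm[OF n] by simp
  finally have F1: "(\<integral>\<^sup>+ y. F y \<partial>lborel) = 1" .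
  have pt: "ennreal ((norm (e n x))\<^sup>2) * indicator {0..h} t \<le>
      ennreal c * indicator {0..h} t + 288 * (\<Sum>j<4. F (x + (\<sigma> * (1 + real j)) * t))" for t
  proof (cases "t \<in> {0..h}")
    case True
    then have t: "0 \<le> t" "t \<le> h" by auto
    have in01: "x + \<sigma> * (1 + real j) * t \<in> {0..1}" if "j < 4" for j
    proof -
      have "(1 + real j) * t \<le> 4 * (1/8)" using that t h by (intro mult_mono) auto
      moreover have "0 \<le> (1 + real j) * t" using t by auto
      ultimately have "x + \<sigma> * ((1 + real j) * t) \<in> {0..1}"
        using x unfolding \<sigma>_def by (cases "x \<le> 1/2") (simp, simp)
      then show ?thesis by (simp only: mult.assoc)
    qed
    have "(norm (e n x))\<^sup>2 \<le> c + 288 * (\<Sum>j<4. (norm (e n (x + (\<sigma> * (1 + real j)) * t)))\<^sup>2)"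
      unfolding c_def using in01[of 3]
      by (intro e_pointwise_le_fourth_difference n x t) (auto simp: \<sigma>_def)
    then have "ennreal ((norm (e n x))\<^sup>2) \<le> ennreal (c + 288 * (\<Sum>j<4. (norm (e n (x + (\<sigma> * (1 + real j)) * t)))\<^sup>2))"
      by (rule ennreal_leI)
    also have "\<dots> = ennreal c + 288 * (\<Sum>j<4. ennreal ((norm (e n (x + (\<sigma> * (1 + real j)) * t)))\<^sup>2))"
      using c0 by (simp add: ennreal_plus ennreal_mult' sum_nonneg)
    also have "(\<Sum>j<4. ennreal ((norm (e n (x + (\<sigma> * (1 + real j)) * t)))\<^sup>2)) = (\<Sum>j<4. F (x + (\<sigma> * (1 + real j)) * t))"
      by (intro sum.cong refl) (use in01 in \<open>auto simp: F_def\<close>)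
    finally show ?thesis using True by simp
  qed simp
  have Fm': "(\<lambda>t. F (x + b * t)) \<in> borel_measurable borel" for b
    using Fm by measurable
  have "ennreal ((norm (e n x))\<^sup>2 * h) = (\<integral>\<^sup>+ t. ennreal ((norm (e n x))\<^sup>2) * indicator {0..h} t \<partial>lborel)"
    using h by (simp add: nn_integral_cmult_indicator ennreal_mult')
  also have "\<dots> \<le> (\<integral>\<^sup>+ t. (ennreal c * indicator {0..h} t + 288 * (\<Sum>j<4. F (x + (\<sigma> * (1 + real j)) * t))) \<partial>lborel)"
    by (intro nn_integral_mono pt)
  also have "\<dots> = ennreal c * h + 288 * (\<Sum>j<4. (\<integral>\<^sup>+ t. F (x + (\<sigma> * (1 + real j)) * t) \<partial>lborel))"
    using Fm' h by (simp add: nn_integral_add nn_integral_cmult nn_integral_sum nn_integral_cmult_indicator)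
  also have "\<dots> \<le> ennreal c * h + 288 * (\<Sum>j<(4::nat). 1)"
  proof (intro add_mono mult_left_mono sum_mono order_refl)
    fix j :: nat
    have "(\<integral>\<^sup>+ t. F (x + (\<sigma> * (1 + real j)) * t) \<partial>lborel) \<le> (\<integral>\<^sup>+ y. F y \<partial>lborel)"
      by (rule nn_integral_dilation_le[OF Fm]) (auto simp: \<sigma>_def)
    then show "(\<integral>\<^sup>+ t. F (x + (\<sigma> * (1 + real j)) * t) \<partial>lborel) \<le> 1" by (simp add: F1)
  qed auto
  also have "\<dots> = ennreal (c * h + 1152)"
    using c0 h by (simp add: ennreal_mult' ennreal_plus)
  finally have "(norm (e n x))\<^sup>2 * h \<le> c * h + 1152"
    using c0 h by (subst (asm) ennreal_le_iff) auto
  then show ?thesis using h unfolding c_def[symmetric] by (simp add: field_simps)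
qed

text \<open>For \<open>h\<close> proportional to \<open>\<mu> n powr (1/4)\<close> the term with
  \<open>h ^ 8 / (\<mu> n)\<^sup>2\<close> is constant and \<open>1 / h\<close> has order
  \<open>\<mu> n powr (-1/4)\<close>. Multiplication by \<open>sqrt (\<mu> n)\<close> then leaves
  order \<open>\<mu> n powr (1/4)\<close>.\<close>

lemma weighted_sup_bound:
  obtains A where "0 \<le> A" "\<And>n x. x \<in> {0..1} \<Longrightarrow> sqrt (\<mu> n) * (norm (e n x))\<^sup>2 \<le> A * \<mu> n powr (1/4)"
proof -
  define m where "m = 1 + \<mu> 0"
  have m1: "1 \<le> m" using mu_nonneg[of 0] by (simp add: m_def)
  \<comment> \<open>Because \<open>\<nu> \<le> m\<close> for every \<open>n\<close>, this makes
    \<open>h = \<eta> * \<nu>\<close> at most 1/8, as \<open>e_sup_le\<close> demands.\<close>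
  define \<eta> where "\<eta> = 1 / (8 * m)"
  have \<eta>: "0 < \<eta>" using m1 by (simp add: \<eta>_def)
  define A where "A = 2 * (24 * K * 4 ^ 4)\<^sup>2 * \<eta> ^ 8 * m + 1152 / \<eta>"
  show ?thesis
  proof
    show A0: "0 \<le> A" using \<eta> m1 by (simp add: A_def)
    fix n x assume x: "x \<in> {0..1::real}"
    show "sqrt (\<mu> n) * (norm (e n x))\<^sup>2 \<le> A * \<mu> n powr (1/4)"
    proof (cases "\<mu> n = 0")
      case False
      then have n: "0 < \<mu> n" using mu_nonneg[of n] by simp
      define \<nu> where "\<nu> = \<mu> n powr (1/4)"
      have \<nu>: "0 < \<nu>" using n by (simp add: \<nu>_def)
      have \<nu>4: "\<mu> n = \<nu> ^ 4" using n by (simp add: \<nu>_def powr_powr flip: powr_realpow)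
      have sq: "sqrt (\<mu> n) = \<nu>\<^sup>2" unfolding \<nu>4 using \<nu> by (intro real_sqrt_unique) (simp_all flip: power_mult)
      have "\<mu> n \<le> m" using mu_decseq by (simp add: m_def decseq_def add.commute add_increasing)
      also have "m \<le> m ^ 4" using m1 power_increasing[of 1 4 m] by simp
      finally have "\<nu> \<le> m" unfolding \<nu>4 using \<nu> m1 power_mono_iff[of \<nu> m 4] by simp
      define h where "h = \<eta> * \<nu>"
      have h: "0 < h" "h \<le> 1/8"
        using \<eta> \<nu> \<open>\<nu> \<le> m\<close> m1 by (auto simp: h_def \<eta>_def divide_le_eq)
      have "(norm (e n x))\<^sup>2 \<le> 2 * (24 * K * (4 * h) ^ 4)\<^sup>2 / (\<mu> n)\<^sup>2 + 1152 / h"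
        by (rule e_sup_le) (use n x h in auto)
      also have "\<dots> = 2 * (24 * K * 4 ^ 4)\<^sup>2 * \<eta> ^ 8 + 1152 / \<eta> / \<nu>"
        using \<nu> \<eta> unfolding \<nu>4 h_def by (simp add: field_simps eval_nat_numeral)
      finally have "\<nu>\<^sup>2 * (norm (e n x))\<^sup>2 \<le> \<nu>\<^sup>2 * (2 * (24 * K * 4 ^ 4)\<^sup>2 * \<eta> ^ 8 + 1152 / \<eta> / \<nu>)"
        by (intro mult_left_mono) auto
      also have "\<dots> = (2 * (24 * K * 4 ^ 4)\<^sup>2 * \<eta> ^ 8 * \<nu> + 1152 / \<eta>) * \<nu>"
        using \<nu> by (simp add: field_simps power2_eq_square)
      also have "\<dots> \<le> A * \<nu>"
        unfolding A_def using \<nu> \<eta> \<open>\<nu> \<le> m\<close> by (intro mult_right_mono add_mono mult_left_mono) auto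
      finally show ?thesis by (simp add: sq \<nu>_def)
    qed simp
  qed
qed

text \<open>The sequence \<open>\<beta>\<close> will dominate the Karhunen-Loeve terms and
  \<open>\<gamma>\<close> the diagonal of the square root of the covariance operator. The bound
  \<open>a \<le> 1 + a\<^sup>2\<close> reduces the first to the second and to the summability of
  \<open>sqrt (\<mu> n)\<close>.\<close>

lemma weighted_sup_summable:
  obtains \<beta> \<gamma> where "summable \<beta>" "summable \<gamma>" "\<And>n. 0 \<le> \<beta> n"
    "\<And>n x. x \<in> {0..1} \<Longrightarrow> sqrt (\<mu> n) * norm (e n x) \<le> \<beta> n"
    "\<And>n x. x \<in> {0..1} \<Longrightarrow> sqrt (\<mu> n) * (norm (e n x))\<^sup>2 \<le> \<gamma> n"
proof -
  obtain A where A: "0 \<le> A" "\<And>n x. x \<in> {0..1} \<Longrightarrow> sqrt (\<mu> n) * (norm (e n x))\<^sup>2 \<le> A * \<mu> n powr (1/4)"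
    using weighted_sup_bound by metis
  define m where "m = (1 + \<mu> 0)"
  have sb: "sqrt (\<mu> n) \<le> m * \<mu> n powr (1/4)" for n
  proof (cases "\<mu> n = 0")
    case False
    then have n: "0 < \<mu> n" using mu_nonneg[of n] by simp
    have "\<mu> n powr (1/4) \<le> (1 + \<mu> n) powr (1/4)" using n by (intro powr_mono2) auto
    also have "\<dots> \<le> (1 + \<mu> n) powr 1" using n by (intro powr_mono) auto
    also have "\<dots> \<le> m" using mu_decseq n by (simp add: m_def decseq_def)
    finally have "\<mu> n powr (1/4) * \<mu> n powr (1/4) \<le> m * \<mu> n powr (1/4)" by (intro mult_right_mono) auto
    moreover have "\<mu> n powr (1/4) * \<mu> n powr (1/4) = sqrt (\<mu> n)"
      using n by (simp add: powr_half_sqrt flip: powr_add)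
    ultimately show ?thesis by simp
  qed simp
  show ?thesis
  proof
    show "summable (\<lambda>n. (m + A) * \<mu> n powr (1/4))" "summable (\<lambda>n. A * \<mu> n powr (1/4))"
      by (intro summable_mult summable_mu_powr)+
    show "0 \<le> (m + A) * \<mu> n powr (1/4)" for n using A mu_nonneg[of 0] by (simp add: m_def)
    fix n x assume x: "x \<in> {0..1::real}"
    show "sqrt (\<mu> n) * (norm (e n x))\<^sup>2 \<le> A * \<mu> n powr (1/4)" using A x by simp
    have "a \<le> 1 + a\<^sup>2" for a :: real using sum_squares_bound[of a 1] by (smt (verit) zero_le_power2 one_power2 mult_1_right)
    then have "sqrt (\<mu> n) * norm (e n x) \<le> sqrt (\<mu> n) * (1 + (norm (e n x))\<^sup>2)"
      using mu_nonneg[of n] by (intro mult_left_mono) auto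
    also have "\<dots> \<le> m * \<mu> n powr (1/4) + A * \<mu> n powr (1/4)"
      using sb[of n] A(2)[OF x, of n] by (simp add: distrib_left)
    finally show "sqrt (\<mu> n) * norm (e n x) \<le> (m + A) * \<mu> n powr (1/4)" by (simp add: distrib_right)
  qed
qed

lemma summable_mu: "summable \<mu>"
proof (rule summable_comparison_test_ev[OF _ summable_mu_powr])
  have "\<forall>\<^sub>F n in sequentially. \<mu> n < 1" using mu_tendsto by (rule order_tendstoD) simp
  then show "\<forall>\<^sub>F n in sequentially. norm (\<mu> n) \<le> \<mu> n powr (1/4)"
  proof eventually_elim
    case (elim n)
    show ?case
    proof (cases "\<mu> n = 0")
      case False
      then have "\<mu> n powr 1 \<le> \<mu> n powr (1/4)" using elim mu_nonneg[of n] by (intro powr_mono') auto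
      then show ?thesis using mu_nonneg[of n] False by simp
    qed simp
  qed
qed

end

section \<open>Tails of Gaussian sequences\<close>

lemma emeasure_annulus:
  fixes c v :: real
  assumes "0 \<le> c"
  shows "emeasure lborel {z::complex. c < (norm z)\<^sup>2 \<and> (norm z)\<^sup>2 \<le> v} = ennreal (pi * (v - c))"
proof (cases "c \<le> v")
  case True
  have cb: "{z::complex. (norm z)\<^sup>2 \<le> a} = cball 0 (sqrt a)" if "0 \<le> a" for a
    using that by (auto simp: real_le_rsqrt) (metis norm_ge_zero power_mono real_sqrt_pow2)
  have em: "emeasure lborel (cball (0::complex) (sqrt a)) = ennreal (pi * a)" if "0 \<le> a" for a
    using that by (simp add: emeasure_cball unit_ball_vol_2)
  have "{z::complex. c < (norm z)\<^sup>2 \<and> (norm z)\<^sup>2 \<le> v} = {z. (norm z)\<^sup>2 \<le> v} - {z. (norm z)\<^sup>2 \<le> c}"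
    by auto
  also have "\<dots> = cball 0 (sqrt v) - cball 0 (sqrt c)"
    using True assms by (simp add: cb)
  also have "emeasure lborel \<dots> = ennreal (pi * v) - ennreal (pi * c)"
    using True assms em[of c] em[of v] by (subst emeasure_Diff) (auto intro: order_trans[OF _ real_sqrt_le_mono])
  finally show ?thesis using assms by (simp add: ennreal_minus right_diff_distrib)
next
  case False
  then have "{z::complex. c < (norm z)\<^sup>2 \<and> (norm z)\<^sup>2 \<le> v} = {}" by auto
  moreover have "pi * (v - c) \<le> 0" using False by (simp add: mult_nonneg_nonpos)
  ultimately show ?thesis by (simp only: ennreal_neg emeasure_empty)
qed

text \<open>Layer-cake: writing \<open>exp (-u)\<close> as the integral of \<open>exp (-v)\<close> over \<open>v \<ge> u\<close> reduces the
  Gaussian tail to areas of annuli, so that no polar coordinates are needed.\<close>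

lemma gaussian_density_tail:
  assumes c: "0 \<le> c"
  shows "(\<integral>\<^sup>+ (z::complex). ennreal (exp (- (norm z)\<^sup>2) / pi) * indicator {z. c < (norm z)\<^sup>2} z \<partial>lborel) = ennreal (exp (- c))"
proof -
  have ex: "(\<integral>\<^sup>+ v. ennreal (exp (- v)) * indicator {u..} v \<partial>lborel) = ennreal (exp (- u))" for u :: real
  proof -
    have "(\<integral>\<^sup>+ v. ennreal (exp (- v)) * indicator {u..} v \<partial>lborel) = ennreal (0 - (- exp (- u)))"
    proof (rule nn_integral_FTC_atLeast)
      show "((\<lambda>v::real. - exp (- v)) \<longlongrightarrow> 0) at_top" by real_asymp
    qed (auto intro!: derivative_eq_intros)
    then show ?thesis by simp
  qed
  have pi: "ennreal (a / pi) = ennreal (1 / pi) * ennreal a" if "0 \<le> a" for a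
    using that by (simp flip: ennreal_mult)
  have "(\<integral>\<^sup>+ (z::complex). ennreal (exp (- (norm z)\<^sup>2) / pi) * indicator {z. c < (norm z)\<^sup>2} z \<partial>lborel)
     = (\<integral>\<^sup>+ (z::complex). (\<integral>\<^sup>+ v. ennreal (1 / pi) * (ennreal (exp (- v)) * indicator {z. c < (norm z)\<^sup>2 \<and> (norm z)\<^sup>2 \<le> v} z) \<partial>lborel) \<partial>lborel)"
  proof (intro nn_integral_cong)
    fix z :: complex
    have "ennreal (exp (- (norm z)\<^sup>2) / pi) * indicator {z. c < (norm z)\<^sup>2} z =
      (ennreal (1 / pi) * indicator {z. c < (norm z)\<^sup>2} z) * (\<integral>\<^sup>+ v. ennreal (exp (- v)) * indicator {(norm z)\<^sup>2..} v \<partial>lborel)"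
      unfolding ex by (subst pi) (auto simp: mult_ac)
    also have "\<dots> = (\<integral>\<^sup>+ v. (ennreal (1 / pi) * indicator {z. c < (norm z)\<^sup>2} z) * (ennreal (exp (- v)) * indicator {(norm z)\<^sup>2..} v) \<partial>lborel)"
      by (rule nn_integral_cmult[symmetric]) measurable
    also have "\<dots> = (\<integral>\<^sup>+ v. ennreal (1 / pi) * (ennreal (exp (- v)) * indicator {z. c < (norm z)\<^sup>2 \<and> (norm z)\<^sup>2 \<le> v} z) \<partial>lborel)"
      by (intro nn_integral_cong) (auto simp: indicator_def)
    finally show "ennreal (exp (- (norm z)\<^sup>2) / pi) * indicator {z. c < (norm z)\<^sup>2} z =
      (\<integral>\<^sup>+ v. ennreal (1 / pi) * (ennreal (exp (- v)) * indicator {z. c < (norm z)\<^sup>2 \<and> (norm z)\<^sup>2 \<le> v} z) \<partial>lborel)" .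
  qed
  also have "\<dots> = (\<integral>\<^sup>+ v. (\<integral>\<^sup>+ (z::complex). ennreal (1 / pi) * (ennreal (exp (- v)) * indicator {z. c < (norm z)\<^sup>2 \<and> (norm z)\<^sup>2 \<le> v} z) \<partial>lborel) \<partial>lborel)"
    by (rule lborel_pair.Fubini') measurable
  also have "\<dots> = (\<integral>\<^sup>+ v. ennreal ((v - c) * exp (- v)) * indicator {c..} v \<partial>lborel)"
  proof (intro nn_integral_cong)
    fix v :: real
    have "(\<integral>\<^sup>+ (z::complex). ennreal (1 / pi) * (ennreal (exp (- v)) * indicator {z. c < (norm z)\<^sup>2 \<and> (norm z)\<^sup>2 \<le> v} z) \<partial>lborel)
      = ennreal (1 / pi) * (ennreal (exp (- v)) * ennreal (pi * (v - c)))"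
      unfolding mult.assoc[symmetric]
      by (subst nn_integral_cmult_indicator) (auto simp: emeasure_annulus[OF c] mult.assoc)
    also have "\<dots> = ennreal ((v - c) * exp (- v)) * indicator {c..} v"
    proof (cases "c \<le> v")
      case True
      then show ?thesis by (simp add: field_simps flip: ennreal_mult)
    next
      case False
      then have "pi * (v - c) \<le> 0" by (simp add: mult_nonneg_nonpos)
      then show ?thesis using False by (simp add: ennreal_neg)
    qed
    finally show "(\<integral>\<^sup>+ (z::complex). ennreal (1 / pi) * (ennreal (exp (- v)) * indicator {z. c < (norm z)\<^sup>2 \<and> (norm z)\<^sup>2 \<le> v} z) \<partial>lborel)
      = ennreal ((v - c) * exp (- v)) * indicator {c..} v" .
  qed
  also have "\<dots> = ennreal (0 - (- ((c - c + 1) * exp (- c))))"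
  proof (rule nn_integral_FTC_atLeast[where F = "\<lambda>v. - ((v - c + 1) * exp (- v))"])
    show "((\<lambda>v::real. - ((v - c + 1) * exp (- v))) \<longlongrightarrow> 0) at_top" by real_asymp
  qed (auto intro!: derivative_eq_intros simp: algebra_simps)
  finally show ?thesis by simp
qed

text \<open>The tail beyond 0 omits only the origin, a null set.\<close>

lemma gaussian_density_total: "(\<integral>\<^sup>+ (z::complex). ennreal (exp (- (norm z)\<^sup>2) / pi) \<partial>lborel) = 1"
proof -
  have "AE z in lborel. z \<noteq> (0::complex)" by (rule AE_lborel_singleton)
  then have "(\<integral>\<^sup>+ (z::complex). ennreal (exp (- (norm z)\<^sup>2) / pi) \<partial>lborel) =
     (\<integral>\<^sup>+ (z::complex). ennreal (exp (- (norm z)\<^sup>2) / pi) * indicator {z. 0 < (norm z)\<^sup>2} z \<partial>lborel)"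
    by (intro nn_integral_cong_AE) (auto elim!: eventually_mono)
  then show ?thesis using gaussian_density_tail[of 0] by (simp only:) simp
qed

text \<open>Scaling by \<open>c = 1 / sqrt (1 - t)\<close> absorbs the exponential weight; the plane
  has real dimension 2, so the Jacobian is \<open>c\<^sup>2 = 1 / (1 - t)\<close>.\<close>

lemma gaussian_density_exp_moment:
  fixes t :: real
  assumes t: "t < 1"
  shows "(\<integral>\<^sup>+ (z::complex). ennreal (exp (- (norm z)\<^sup>2) / pi) * ennreal (exp (t * (norm z)\<^sup>2)) \<partial>lborel) = ennreal (1 / (1 - t))"
proof -
  define c where "c = 1 / sqrt (1 - t)"
  have c: "0 < c" using t by (simp add: c_def)
  have c2: "c\<^sup>2 = 1 / (1 - t)" using t by (simp add: c_def power_divide)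
  define f :: "complex \<Rightarrow> ennreal" where "f z = ennreal (exp (- (1 - t) * (norm z)\<^sup>2) / pi)" for z
  have fm: "f \<in> borel_measurable borel" unfolding f_def by measurable
  have "(\<integral>\<^sup>+ z. f z \<partial>lborel) = (\<integral>\<^sup>+ z. ennreal (c\<^sup>2) * f (c *\<^sub>R z) \<partial>lborel)"
    using fm c by (subst lborel_affine[of c 0])
      (simp_all add: nn_integral_density nn_integral_distr)
  also have "\<dots> = (\<integral>\<^sup>+ (z::complex). ennreal (c\<^sup>2) * ennreal (exp (- (norm z)\<^sup>2) / pi) \<partial>lborel)"
  proof (intro nn_integral_cong)
    fix z :: complex
    have "(1 - t) * (norm (c *\<^sub>R z))\<^sup>2 = (norm z)\<^sup>2" using c t by (simp add: power_mult_distrib c2)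
    then show "ennreal (c\<^sup>2) * f (c *\<^sub>R z) = ennreal (c\<^sup>2) * ennreal (exp (- (norm z)\<^sup>2) / pi)"
      by (simp only: f_def mult_minus_left)
  qed
  also have "\<dots> = ennreal (c\<^sup>2)"
    by (subst nn_integral_cmult) (simp_all add: gaussian_density_total)
  finally have "(\<integral>\<^sup>+ z. f z \<partial>lborel) = ennreal (1 / (1 - t))" by (simp add: c2)
  moreover have "f z = ennreal (exp (- (norm z)\<^sup>2) / pi) * ennreal (exp (t * (norm z)\<^sup>2))" for z
    by (simp add: f_def left_diff_distrib mult_exp_exp flip: ennreal_mult)
  ultimately show ?thesis by simp
qed

lemma std_complex_gaussian_measurable: "std_complex_gaussian M X \<Longrightarrow> X \<in> borel_measurable M"
  unfolding std_complex_gaussian_def using distributed_measurable by fastforce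

lemma std_complex_gaussian_tail:
  assumes "std_complex_gaussian M X" "0 \<le> c"
  shows "emeasure M {\<omega> \<in> space M. c < (norm (X \<omega>))\<^sup>2} = ennreal (exp (- c))"
proof -
  have "emeasure M (X -` {z. c < (norm z)\<^sup>2} \<inter> space M) = ennreal (exp (- c))"
    using assms gaussian_density_tail[of c] unfolding std_complex_gaussian_def
    by (subst distributed_emeasure) auto
  moreover have "X -` {z. c < (norm z)\<^sup>2} \<inter> space M = {\<omega> \<in> space M. c < (norm (X \<omega>))\<^sup>2}" by auto
  ultimately show ?thesis by simp
qed

lemma std_complex_gaussian_exp_moment:
  assumes "std_complex_gaussian M X" "t < 1"
  shows "(\<integral>\<^sup>+ \<omega>. ennreal (exp (t * (norm (X \<omega>))\<^sup>2)) \<partial>M) = ennreal (1 / (1 - t))"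
  using assms gaussian_density_exp_moment[of t] unfolding std_complex_gaussian_def
  by (subst distributed_nn_integral[symmetric]) auto

section \<open>Independence and shifted exponential tails\<close>

context prob_space begin

text \<open>Independence makes the joint law a product, so by Tonelli \<open>Y\<close> may be
  averaged over a separate copy \<open>\<omega>'\<close> while \<open>X\<close> is frozen at
  \<open>\<omega>\<close>.\<close>

lemma nn_integral_indep_pair:
  assumes ind: "indep_var S X T Y" and f[measurable]: "f \<in> borel_measurable (S \<Otimes>\<^sub>M T)"
  shows "(\<integral>\<^sup>+ \<omega>. f (X \<omega>, Y \<omega>) \<partial>M) = (\<integral>\<^sup>+ \<omega>. (\<integral>\<^sup>+ \<omega>'. f (X \<omega>, Y \<omega>') \<partial>M) \<partial>M)"
proof -
  have X[measurable]: "X \<in> measurable M S" and Y[measurable]: "Y \<in> measurable M T"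
    and eq: "distr M S X \<Otimes>\<^sub>M distr M T Y = distr M (S \<Otimes>\<^sub>M T) (\<lambda>\<omega>. (X \<omega>, Y \<omega>))"
    using ind by (auto simp: indep_var_distribution_eq)
  interpret Y: prob_space "distr M T Y" by (rule prob_space_distr) fact
  have "(\<integral>\<^sup>+ \<omega>. f (X \<omega>, Y \<omega>) \<partial>M) = (\<integral>\<^sup>+ p. f p \<partial>(distr M S X \<Otimes>\<^sub>M distr M T Y))"
    unfolding eq by (subst nn_integral_distr) auto
  also have "\<dots> = (\<integral>\<^sup>+ x. (\<integral>\<^sup>+ y. f (x, y) \<partial>distr M T Y) \<partial>distr M S X)"
    by (subst Y.nn_integral_fst[symmetric]) auto
  also have "\<dots> = (\<integral>\<^sup>+ x. (\<integral>\<^sup>+ \<omega>'. f (x, Y \<omega>') \<partial>M) \<partial>distr M S X)"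
    by (intro nn_integral_cong nn_integral_distr) auto
  also have "\<dots> = (\<integral>\<^sup>+ \<omega>. (\<integral>\<^sup>+ \<omega>'. f (X \<omega>, Y \<omega>') \<partial>M) \<partial>M)"
    by (intro nn_integral_distr) auto
  finally show ?thesis .
qed

text \<open>The exponential law of \<open>W\<close> satisfies \<open>P(W > c - b) \<le> exp b * P(W > c)\<close>, so an independent
  perturbation \<open>V \<ge> 0\<close> of the threshold only costs a factor \<open>exp (V / \<kappa>)\<close>.\<close>

lemma exponential_tail_shift:
  fixes W ::"'b \<Rightarrow> real" and Z V :: "'b \<Rightarrow> real" and G :: "'b \<Rightarrow> ennreal"
  assumes ind: "indep_var T Y S X"
    and tail: "\<And>c. 0 \<le> c \<Longrightarrow> emeasure M {\<omega> \<in> space M. c < W (X \<omega>)} = ennreal (exp (- c))"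
    and \<kappa>: "0 < \<kappa>" and V0: "\<And>y. 0 \<le> V y"
    and [measurable]: "W \<in> borel_measurable S" "G \<in> borel_measurable T" "Z \<in> borel_measurable T" "V \<in> borel_measurable T"
  shows "(\<integral>\<^sup>+ \<omega>. G (Y \<omega>) * indicator {\<omega>. r < \<kappa> * W (X \<omega>) + Z (Y \<omega>) + V (Y \<omega>)} \<omega> \<partial>M) \<le>
    (\<integral>\<^sup>+ \<omega>. G (Y \<omega>) * ennreal (exp (V (Y \<omega>) / \<kappa>)) * indicator {\<omega>. r < \<kappa> * W (X \<omega>) + Z (Y \<omega>)} \<omega> \<partial>M)"
proof -
  have Y[measurable]: "Y \<in> measurable M T" and X[measurable]: "X \<in> measurable M S"
    using ind by (auto simp: indep_var_distribution_eq)
  \<comment> \<open>Equality holds if both thresholds are nonnegative. If only \<open>c - b\<close>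
    is negative the right side is at least 1, and if \<open>c\<close> is negative then
    \<open>W\<close> exceeds \<open>c\<close> almost surely.\<close>
  have shift: "emeasure M {\<omega> \<in> space M. c - b < W (X \<omega>)} \<le> ennreal (exp b) * emeasure M {\<omega> \<in> space M. c < W (X \<omega>)}"
    if b: "0 \<le> b" for b c
  proof (cases "0 \<le> c")
    case True
    show ?thesis
    proof (cases "0 \<le> c - b")
      case True
      then show ?thesis using \<open>0 \<le> c\<close> by (simp add: tail ennreal_mult' mult_exp_exp flip: ennreal_mult)
    next
      case False
      then have "1 \<le> ennreal (exp b * exp (- c))" by (simp add: mult_exp_exp)
      then show ?thesis using \<open>0 \<le> c\<close>
        by (simp add: tail ennreal_mult) (meson emeasure_space_1 emeasure_le_1 order_trans)
    qed
  next
    case False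
    have "1 = emeasure M {\<omega> \<in> space M. 0 < W (X \<omega>)}" using tail[of 0] by simp
    also have "\<dots> \<le> emeasure M {\<omega> \<in> space M. c < W (X \<omega>)}" using False by (intro emeasure_mono) auto
    finally have "1 * 1 \<le> ennreal (exp b) * emeasure M {\<omega> \<in> space M. c < W (X \<omega>)}"
      using b by (intro mult_mono) auto
    then show ?thesis using emeasure_le_1[of "{\<omega> \<in> space M. c - b < W (X \<omega>)}"] by (simp add: order_trans)
  qed
  have "(\<integral>\<^sup>+ \<omega>. G (Y \<omega>) * indicator {\<omega>. r < \<kappa> * W (X \<omega>) + Z (Y \<omega>) + V (Y \<omega>)} \<omega> \<partial>M) =
    (\<integral>\<^sup>+ \<omega>. (\<integral>\<^sup>+ \<omega>'. G (Y \<omega>) * indicator {\<omega>'. r < \<kappa> * W (X \<omega>') + Z (Y \<omega>) + V (Y \<omega>)} \<omega>' \<partial>M) \<partial>M)"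
    using nn_integral_indep_pair[OF ind, of "\<lambda>(y, x). G y * indicator {x. r < \<kappa> * W x + Z y + V y} x"]
    by (simp add: indicator_def)
  also have "\<dots> \<le> (\<integral>\<^sup>+ \<omega>. (\<integral>\<^sup>+ \<omega>'. G (Y \<omega>) * ennreal (exp (V (Y \<omega>) / \<kappa>)) * indicator {\<omega>'. r < \<kappa> * W (X \<omega>') + Z (Y \<omega>)} \<omega>' \<partial>M) \<partial>M)"
  proof (rule nn_integral_mono)
    fix \<omega>
    have int: "(\<integral>\<^sup>+ \<omega>'. g * indicator {\<omega>'. c < W (X \<omega>')} \<omega>' \<partial>M) = g * emeasure M {\<omega> \<in> space M. c < W (X \<omega>)}" for g c
    proof -
      have "(\<integral>\<^sup>+ \<omega>'. g * indicator {\<omega>'. c < W (X \<omega>')} \<omega>' \<partial>M) = (\<integral>\<^sup>+ \<omega>'. g * indicator {\<omega> \<in> space M. c < W (X \<omega>)} \<omega>' \<partial>M)"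
        by (intro nn_integral_cong) (auto simp: indicator_def)
      then show ?thesis by (simp add: nn_integral_cmult_indicator)
    qed
    define c where "c = (r - Z (Y \<omega>)) / \<kappa>"
    define b where "b = V (Y \<omega>) / \<kappa>"
    have cb: "c - b = (r - Z (Y \<omega>) - V (Y \<omega>)) / \<kappa>" by (simp add: c_def b_def diff_divide_distrib)
    have 1: "{\<omega>'. r < \<kappa> * W (X \<omega>') + Z (Y \<omega>) + V (Y \<omega>)} = {\<omega>'. c - b < W (X \<omega>')}"
      and 2: "{\<omega>'. r < \<kappa> * W (X \<omega>') + Z (Y \<omega>)} = {\<omega>'. c < W (X \<omega>')}"
      unfolding cb unfolding c_def using \<kappa> by (auto simp: pos_divide_less_eq algebra_simps)
    show "(\<integral>\<^sup>+ \<omega>'. G (Y \<omega>) * indicator {\<omega>'. r < \<kappa> * W (X \<omega>') + Z (Y \<omega>) + V (Y \<omega>)} \<omega>' \<partial>M) \<le>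
      (\<integral>\<^sup>+ \<omega>'. G (Y \<omega>) * ennreal (exp (V (Y \<omega>) / \<kappa>)) * indicator {\<omega>'. r < \<kappa> * W (X \<omega>') + Z (Y \<omega>)} \<omega>' \<partial>M)"
      unfolding 1 2 int b_def[symmetric] unfolding mult.assoc
      using V0 \<kappa> by (intro mult_left_mono shift) (auto simp: b_def)
  qed
  also have "\<dots> = (\<integral>\<^sup>+ \<omega>. G (Y \<omega>) * ennreal (exp (V (Y \<omega>) / \<kappa>)) * indicator {\<omega>. r < \<kappa> * W (X \<omega>) + Z (Y \<omega>)} \<omega> \<partial>M)"
    using nn_integral_indep_pair[OF ind, of "\<lambda>(y, x). G y * ennreal (exp (V y / \<kappa>)) * indicator {x. r < \<kappa> * W x + Z y} x"]
    by (simp add: indicator_def)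
  finally show ?thesis .
qed

end

lemma borel_measurable_component_norm:
  "k \<in> I \<Longrightarrow> (\<lambda>y. norm (y k :: complex)) \<in> borel_measurable (PiM I (\<lambda>_. borel))"
  by measurable

lemma borel_measurable_component_norm_sq:
  "k \<in> I \<Longrightarrow> (\<lambda>y. (norm (y k :: complex))\<^sup>2) \<in> borel_measurable (PiM I (\<lambda>_. borel))"
  by (intro borel_measurable_power borel_measurable_component_norm)

section \<open>Weighted sums of independent squared Gaussians\<close>

locale complex_gaussian_sequence = prob_space +
  fixes s :: "nat \<Rightarrow> 'a \<Rightarrow> complex"
  assumes indep: "indep_vars (\<lambda>_. borel) s UNIV" and gauss: "\<And>n. std_complex_gaussian M (s n)"
begin

lemma s_measurable[measurable]: "s n \<in> borel_measurable M"
  using gauss by (rule std_complex_gaussian_measurable)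

text \<open>The factor \<open>norm (s n \<omega>)\<close> is absorbed by raising the exponent at
  index \<open>n\<close> by \<open>\<epsilon>\<close>. Independence then gives a product of
  \<open>1 / (1 - u k)\<close>, each at most \<open>exp (u k / \<epsilon>)\<close>, so the bound
  depends on \<open>F\<close> only through the sum of the exponents. This uniformity permits
  infinitely many modes later.\<close>

lemma exp_moment_le:
  assumes F: "finite F" "n \<in> F" and t: "\<And>k. k \<in> F \<Longrightarrow> 0 \<le> t k \<and> t k \<le> \<tau>" and \<tau>: "\<tau> < 1"
    and T: "(\<Sum>k\<in>F. t k) \<le> T"
  shows "(\<integral>\<^sup>+ \<omega>. ennreal (norm (s n \<omega>)) * ennreal (exp (\<Sum>k\<in>F. t k * (norm (s k \<omega>))\<^sup>2)) \<partial>M) \<le>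
    ennreal (2 / (1 - \<tau>) * exp ((T + 1) / ((1 - \<tau>) / 2)))"
proof -
  \<comment> \<open>Half of the gap to 1: after the raise at index \<open>n\<close> every exponent
    is still at least \<open>\<epsilon>\<close> below 1.\<close>
  define \<epsilon> where "\<epsilon> = (1 - \<tau>) / 2"
  have \<tau>0: "0 \<le> \<tau>" using t F(2) by force
  have \<epsilon>: "0 < \<epsilon>" "\<epsilon> \<le> 1" using \<tau> \<tau>0 by (auto simp: \<epsilon>_def)
  define u where "u k = (if k = n then t k + \<epsilon> else t k)" for k
  have u: "0 \<le> u k" "u k \<le> 1 - \<epsilon>" if "k \<in> F" for k
    using t[OF that] \<epsilon> \<tau> by (auto simp: u_def \<epsilon>_def field_simps)
  have us: "(\<Sum>k\<in>F. u k) = (\<Sum>k\<in>F. t k) + \<epsilon>"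
  proof -
    have "(\<Sum>k\<in>F. u k) = (\<Sum>k\<in>F. t k + (if k = n then \<epsilon> else 0))" by (intro sum.cong) (auto simp: u_def)
    then show ?thesis using F by (simp add: sum.distrib)
  qed
  have pt: "norm (s n \<omega>) * exp (\<Sum>k\<in>F. t k * (norm (s k \<omega>))\<^sup>2) \<le> (1 / \<epsilon>) * (\<Prod>k\<in>F. exp (u k * (norm (s k \<omega>))\<^sup>2))" for \<omega>
  proof -
    have "\<epsilon> * norm (s n \<omega>) \<le> \<epsilon> * (1 + (norm (s n \<omega>))\<^sup>2)"
      using sum_squares_bound[of "norm (s n \<omega>)" 1] \<epsilon> norm_ge_zero[of "s n \<omega>"]
      by (intro mult_left_mono) (auto simp del: norm_ge_zero)
    also have "\<dots> \<le> 1 + \<epsilon> * (norm (s n \<omega>))\<^sup>2" using \<epsilon> by (simp add: distrib_left)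
    also have "\<dots> \<le> exp (\<epsilon> * (norm (s n \<omega>))\<^sup>2)" by (rule exp_ge_add_one_self)
    finally have "norm (s n \<omega>) \<le> (1 / \<epsilon>) * exp (\<epsilon> * (norm (s n \<omega>))\<^sup>2)"
      using \<epsilon> by (simp add: field_simps)
    then have "norm (s n \<omega>) * exp (\<Sum>k\<in>F. t k * (norm (s k \<omega>))\<^sup>2) \<le>
       (1 / \<epsilon>) * exp (\<epsilon> * (norm (s n \<omega>))\<^sup>2) * exp (\<Sum>k\<in>F. t k * (norm (s k \<omega>))\<^sup>2)"
      by (rule mult_right_mono) simp
    also have "\<dots> = (1 / \<epsilon>) * exp (\<Sum>k\<in>F. u k * (norm (s k \<omega>))\<^sup>2)"
    proof -
      have "(\<Sum>k\<in>F. u k * (norm (s k \<omega>))\<^sup>2) = (\<Sum>k\<in>F. t k * (norm (s k \<omega>))\<^sup>2 + (if k = n then \<epsilon> * (norm (s k \<omega>))\<^sup>2 else 0))"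
        by (intro sum.cong) (auto simp: u_def distrib_right)
      also have "\<dots> = (\<Sum>k\<in>F. t k * (norm (s k \<omega>))\<^sup>2) + \<epsilon> * (norm (s n \<omega>))\<^sup>2"
        using F by (simp add: sum.distrib)
      finally show ?thesis by (simp add: exp_add)
    qed
    finally show ?thesis using F by (simp add: exp_sum)
  qed
  have "(\<integral>\<^sup>+ \<omega>. ennreal (norm (s n \<omega>)) * ennreal (exp (\<Sum>k\<in>F. t k * (norm (s k \<omega>))\<^sup>2)) \<partial>M) \<le>
     (\<integral>\<^sup>+ \<omega>. ennreal (1 / \<epsilon>) * (\<Prod>k\<in>F. ennreal (exp (u k * (norm (s k \<omega>))\<^sup>2))) \<partial>M)"
  proof (rule nn_integral_mono)
    fix \<omega>
    have "ennreal (norm (s n \<omega>)) * ennreal (exp (\<Sum>k\<in>F. t k * (norm (s k \<omega>))\<^sup>2)) \<le>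
        ennreal ((1 / \<epsilon>) * (\<Prod>k\<in>F. exp (u k * (norm (s k \<omega>))\<^sup>2)))"
      using pt[of \<omega>] by (simp add: ennreal_leI flip: ennreal_mult)
    also have "\<dots> = ennreal (1 / \<epsilon>) * ennreal (\<Prod>k\<in>F. exp (u k * (norm (s k \<omega>))\<^sup>2))"
      using \<epsilon> by (intro ennreal_mult prod_nonneg) auto
    also have "ennreal (\<Prod>k\<in>F. exp (u k * (norm (s k \<omega>))\<^sup>2)) = (\<Prod>k\<in>F. ennreal (exp (u k * (norm (s k \<omega>))\<^sup>2)))"
      by (rule prod_ennreal[symmetric]) simp
    finally show "ennreal (norm (s n \<omega>)) * ennreal (exp (\<Sum>k\<in>F. t k * (norm (s k \<omega>))\<^sup>2)) \<le>
        ennreal (1 / \<epsilon>) * (\<Prod>k\<in>F. ennreal (exp (u k * (norm (s k \<omega>))\<^sup>2)))" .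
  qed
  also have "\<dots> = ennreal (1 / \<epsilon>) * (\<integral>\<^sup>+ \<omega>. (\<Prod>k\<in>F. ennreal (exp (u k * (norm (s k \<omega>))\<^sup>2))) \<partial>M)"
    by (rule nn_integral_cmult) measurable
  also have "(\<integral>\<^sup>+ \<omega>. (\<Prod>k\<in>F. ennreal (exp (u k * (norm (s k \<omega>))\<^sup>2))) \<partial>M) =
      (\<Prod>k\<in>F. \<integral>\<^sup>+ \<omega>. ennreal (exp (u k * (norm (s k \<omega>))\<^sup>2)) \<partial>M)"
  proof (rule indep_vars_nn_integral)
    have "indep_vars (\<lambda>_. borel) s F" using indep_vars_subset[OF indep] by simp
    then show "indep_vars (\<lambda>_. borel) (\<lambda>k \<omega>. ennreal (exp (u k * (norm (s k \<omega>))\<^sup>2))) F"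
      by (rule indep_vars_compose2[where Y = "\<lambda>k z. ennreal (exp (u k * (norm z)\<^sup>2))"]) measurable
  qed (use F in auto)
  also have "\<dots> = (\<Prod>k\<in>F. ennreal (1 / (1 - u k)))"
  proof (intro prod.cong std_complex_gaussian_exp_moment gauss refl)
    show "u k < 1" if "k \<in> F" for k using u(2)[OF that] \<epsilon> by simp
  qed
  also have "\<dots> = ennreal (\<Prod>k\<in>F. 1 / (1 - u k))"
  proof (intro prod_ennreal)
    show "0 \<le> 1 / (1 - u k)" if "k \<in> F" for k using u(2)[OF that] \<epsilon> by simp
  qed
  also have "\<dots> \<le> ennreal (\<Prod>k\<in>F. exp (u k / \<epsilon>))"
  proof (intro ennreal_leI prod_mono conjI)
    fix k assume k: "k \<in> F"
    have pos: "\<epsilon> \<le> 1 - u k" using u[OF k] by simp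
    show "0 \<le> 1 / (1 - u k)" using pos \<epsilon> by simp
    have "1 / (1 - u k) = 1 + u k / (1 - u k)" using pos \<epsilon> by (simp add: field_simps)
    also have "\<dots> \<le> 1 + u k / \<epsilon>" using pos \<epsilon> u[OF k] by (intro add_left_mono divide_left_mono) auto
    also have "\<dots> \<le> exp (u k / \<epsilon>)" by (rule exp_ge_add_one_self)
    finally show "1 / (1 - u k) \<le> exp (u k / \<epsilon>)" .
  qed
  also have "(\<Prod>k\<in>F. exp (u k / \<epsilon>)) = exp ((\<Sum>k\<in>F. u k) / \<epsilon>)"
    using F by (simp add: exp_sum sum_divide_distrib)
  also have "ennreal (1 / \<epsilon>) * ennreal (exp ((\<Sum>k\<in>F. u k) / \<epsilon>)) \<le> ennreal (1 / \<epsilon>) * ennreal (exp ((T + 1) / \<epsilon>))"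
    using T \<epsilon> by (intro mult_left_mono ennreal_leI) (auto simp: us intro!: divide_right_mono)
  also have "\<dots> = ennreal (1 / \<epsilon> * exp ((T + 1) / \<epsilon>))" using \<epsilon> by (intro ennreal_mult[symmetric]) auto
  finally show ?thesis by (simp add: \<epsilon>_def mult_left_mono)
qed

text \<open>Three blocks of modes are separated: index 0, whose squared modulus is exponential; the
  other top indices, which stay in the threshold as \<open>Z\<close>; and the indices from
  \<open>g\<close> on, whose contribution \<open>V\<close> is traded for a factor
  \<open>exp (V / \<kappa>)\<close>. The gap \<open>\<tau> < 1\<close> makes the expectation of that
  factor finite.\<close>

lemma finite_tail_bound:
  assumes \<mu>: "\<And>k. 0 \<le> \<mu> k" and \<kappa>: "0 < \<kappa>" and g: "0 < g" and top: "\<And>k. k < g \<Longrightarrow> \<mu> k = \<kappa>"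
    and gap: "\<And>k. g \<le> k \<Longrightarrow> \<mu> k / \<kappa> \<le> \<tau>" "\<tau> < 1" and T: "(\<Sum>k\<in>{g..<N}. \<mu> k / \<kappa>) \<le> T"
    and n: "g \<le> n" "n < N"
  shows "(\<integral>\<^sup>+ \<omega>. ennreal (norm (s n \<omega>)) * indicator {\<omega>. r < (\<Sum>k<N. \<mu> k * (norm (s k \<omega>))\<^sup>2)} \<omega> \<partial>M) \<le>
    ennreal (2 / (1 - \<tau>) * exp ((T + 1) / ((1 - \<tau>) / 2))) *
      emeasure M {\<omega> \<in> space M. r < (\<Sum>k<g. \<mu> k * (norm (s k \<omega>))\<^sup>2)}"
proof -
  define P where "P I = PiM I (\<lambda>_::nat. borel :: complex measure)" for I
  define R where "R I \<omega> = restrict (\<lambda>i. s i \<omega>) I" for I \<omega>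
  have ind: "indep_var (P A) (R A) (P B) (R B)" if "A \<inter> B = {}" for A B
    using indep_var_restrict[OF indep that] by (simp add: P_def R_def[abs_def])
  define Z where "Z y = (\<Sum>k\<in>{1..<g}. \<mu> k * (norm (y k :: complex))\<^sup>2)" for y :: "nat \<Rightarrow> complex"
  define V where "V y = (\<Sum>k\<in>{g..<N}. \<mu> k * (norm (y k))\<^sup>2)" for y :: "nat \<Rightarrow> complex"
  define U where "U y = (\<Sum>k<g. \<mu> k * (norm (y k))\<^sup>2)" for y :: "nat \<Rightarrow> complex"
  define G where "G y = ennreal (norm (y n))" for y :: "nat \<Rightarrow> complex"
  have comp: "(\<lambda>y. (norm (y k))\<^sup>2) \<in> borel_measurable (P I)" if "k \<in> I" for k I
    unfolding P_def by (rule borel_measurable_component_norm_sq) fact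
  have Zm: "Z \<in> borel_measurable (P {1..<N})"
    unfolding Z_def using n by (intro borel_measurable_sum borel_measurable_times comp) auto
  have Vm: "V \<in> borel_measurable (P I)" if "{g..<N} \<subseteq> I" for I
    unfolding V_def using that by (intro borel_measurable_sum borel_measurable_times comp) auto
  have Um: "U \<in> borel_measurable (P {..<g})"
    unfolding U_def by (intro borel_measurable_sum borel_measurable_times comp) auto
  have Gm: "G \<in> borel_measurable (P I)" if "n \<in> I" for I
    unfolding G_def P_def using that
    by (intro measurable_compose[OF _ measurable_ennreal] borel_measurable_component_norm)
  have V0: "0 \<le> V y" for y unfolding V_def using \<mu> by (intro sum_nonneg) auto
  have U: "U (R {..<g} \<omega>) = \<kappa> * (norm (s 0 \<omega>))\<^sup>2 + Z (R {1..<N} \<omega>)" for \<omega>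
  proof -
    have "U (R {..<g} \<omega>) = (\<Sum>k<g. \<mu> k * (norm (s k \<omega>))\<^sup>2)" by (simp add: U_def R_def)
    also have "\<dots> = (\<Sum>k\<in>insert 0 {1..<g}. \<mu> k * (norm (s k \<omega>))\<^sup>2)"
      using g by (intro sum.cong) auto
    also have "\<dots> = \<kappa> * (norm (s 0 \<omega>))\<^sup>2 + Z (R {1..<N} \<omega>)"
      using n top[OF g] by (simp add: Z_def R_def)
    finally show ?thesis .
  qed
  have VR: "V (R I \<omega>) = (\<Sum>k\<in>{g..<N}. \<mu> k * (norm (s k \<omega>))\<^sup>2)" if "{g..<N} \<subseteq> I" for I \<omega>
    unfolding V_def R_def by (intro sum.cong) (use that in auto)
  have tot: "(\<Sum>k<N. \<mu> k * (norm (s k \<omega>))\<^sup>2) = \<kappa> * (norm (s 0 \<omega>))\<^sup>2 + Z (R {1..<N} \<omega>) + V (R {1..<N} \<omega>)" for \<omega>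
  proof -
    have "{..<N} = {..<g} \<union> {g..<N}" using n by auto
    then have "(\<Sum>k<N. \<mu> k * (norm (s k \<omega>))\<^sup>2) = (\<Sum>k<g. \<mu> k * (norm (s k \<omega>))\<^sup>2) + (\<Sum>k\<in>{g..<N}. \<mu> k * (norm (s k \<omega>))\<^sup>2)"
      by (simp add: sum.union_disjoint ivl_disj_int)
    then show ?thesis using VR[of "{1..<N}" \<omega>] g U[of \<omega>] by (simp add: U_def R_def)
  qed
  have GR: "G (R I \<omega>) = ennreal (norm (s n \<omega>))" if "n \<in> I" for I \<omega> using that by (simp add: G_def R_def)
  have "(\<integral>\<^sup>+ \<omega>. ennreal (norm (s n \<omega>)) * indicator {\<omega>. r < (\<Sum>k<N. \<mu> k * (norm (s k \<omega>))\<^sup>2)} \<omega> \<partial>M) =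
    (\<integral>\<^sup>+ \<omega>. G (R {1..<N} \<omega>) * indicator {\<omega>. r < \<kappa> * (norm (R {0} \<omega> 0))\<^sup>2 + Z (R {1..<N} \<omega>) + V (R {1..<N} \<omega>)} \<omega> \<partial>M)"
    using g n by (simp add: tot GR) (simp add: R_def)
  also have "\<dots> \<le> (\<integral>\<^sup>+ \<omega>. G (R {1..<N} \<omega>) * ennreal (exp (V (R {1..<N} \<omega>) / \<kappa>)) *
      indicator {\<omega>. r < \<kappa> * (norm (R {0} \<omega> 0))\<^sup>2 + Z (R {1..<N} \<omega>)} \<omega> \<partial>M)"
  \<comment> \<open>Both \<open>Z\<close> and \<open>V\<close> are functions of the block
    \<open>{1..<N}\<close>, so one independence from the coordinate 0 covers them together.\<close>
  proof (rule exponential_tail_shift[where W = "\<lambda>x. (norm (x 0))\<^sup>2" and X = "R {0}" and S = "P {0}" and T = "P {1..<N}"])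
    show "indep_var (P {1..<N}) (R {1..<N}) (P {0}) (R {0})" by (rule ind) auto
    show "emeasure M {\<omega> \<in> space M. c < (norm (R {0} \<omega> 0))\<^sup>2} = ennreal (exp (- c))" if "0 \<le> c" for c
      using std_complex_gaussian_tail[OF gauss that] by (simp add: R_def)
  qed (use \<kappa> V0 g n in \<open>auto intro!: comp Zm Vm Gm simp del: One_nat_def\<close>)
  \<comment> \<open>Now the weight depends on the block \<open>{g..<N}\<close> alone and the event
    on \<open>{..<g}\<close> alone, so a second independence factors the integral.\<close>
  also have "\<dots> = (\<integral>\<^sup>+ \<omega>. G (R {g..<N} \<omega>) * ennreal (exp (V (R {g..<N} \<omega>) / \<kappa>)) * indicator {\<omega>. r < U (R {..<g} \<omega>)} \<omega> \<partial>M)"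
    using g n VR[of "{g..<N}"] VR[of "{1..<N}"] by (simp add: U GR) (simp add: R_def)
  also have "\<dots> = (\<integral>\<^sup>+ \<omega>. (\<integral>\<^sup>+ \<omega>'. G (R {g..<N} \<omega>) * ennreal (exp (V (R {g..<N} \<omega>) / \<kappa>)) * indicator {\<omega>. r < U (R {..<g} \<omega>)} \<omega>' \<partial>M) \<partial>M)"
  proof -
    have [measurable]: "G \<in> borel_measurable (P {g..<N})" "V \<in> borel_measurable (P {g..<N})" "U \<in> borel_measurable (P {..<g})"
      using n Gm Vm Um by auto
    have "indep_var (P {g..<N}) (R {g..<N}) (P {..<g}) (R {..<g})" by (rule ind) auto
    from nn_integral_indep_pair[OF this, of "\<lambda>(y, x). G y * ennreal (exp (V y / \<kappa>)) * indicator {x. r < U x} x"]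
    show ?thesis by (simp add: indicator_def)
  qed
  also have "\<dots> = (\<integral>\<^sup>+ \<omega>. G (R {g..<N} \<omega>) * ennreal (exp (V (R {g..<N} \<omega>) / \<kappa>)) * emeasure M {\<omega> \<in> space M. r < U (R {..<g} \<omega>)} \<partial>M)"
  proof (intro nn_integral_cong)
    fix \<omega>
    have [measurable]: "(\<lambda>\<omega>. U (R {..<g} \<omega>)) \<in> borel_measurable M"
      by (simp add: U_def R_def)
    have "(\<integral>\<^sup>+ \<omega>'. h * indicator {\<omega>. r < U (R {..<g} \<omega>)} \<omega>' \<partial>M) = (\<integral>\<^sup>+ \<omega>'. h * indicator {\<omega> \<in> space M. r < U (R {..<g} \<omega>)} \<omega>' \<partial>M)" for h
      by (intro nn_integral_cong) (auto simp: indicator_def)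
    then show "(\<integral>\<^sup>+ \<omega>'. G (R {g..<N} \<omega>) * ennreal (exp (V (R {g..<N} \<omega>) / \<kappa>)) * indicator {\<omega>. r < U (R {..<g} \<omega>)} \<omega>' \<partial>M) =
      G (R {g..<N} \<omega>) * ennreal (exp (V (R {g..<N} \<omega>) / \<kappa>)) * emeasure M {\<omega> \<in> space M. r < U (R {..<g} \<omega>)}"
      by (simp add: nn_integral_cmult_indicator)
  qed
  also have "\<dots> = (\<integral>\<^sup>+ \<omega>. ennreal (norm (s n \<omega>)) * ennreal (exp (\<Sum>k\<in>{g..<N}. \<mu> k / \<kappa> * (norm (s k \<omega>))\<^sup>2)) \<partial>M) *
      emeasure M {\<omega> \<in> space M. r < (\<Sum>k<g. \<mu> k * (norm (s k \<omega>))\<^sup>2)}"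
  proof -
    have "V (R {g..<N} \<omega>) / \<kappa> = (\<Sum>k\<in>{g..<N}. \<mu> k / \<kappa> * (norm (s k \<omega>))\<^sup>2)" for \<omega>
      by (simp add: VR sum_divide_distrib)
    moreover have "U (R {..<g} \<omega>) = (\<Sum>k<g. \<mu> k * (norm (s k \<omega>))\<^sup>2)" for \<omega> by (simp add: U_def R_def)
    ultimately show ?thesis using n by (subst nn_integral_multc[symmetric]) (auto simp: GR)
  qed
  also have "\<dots> \<le> ennreal (2 / (1 - \<tau>) * exp ((T + 1) / ((1 - \<tau>) / 2))) *
      emeasure M {\<omega> \<in> space M. r < (\<Sum>k<g. \<mu> k * (norm (s k \<omega>))\<^sup>2)}"
    using n gap \<mu> \<kappa> T by (intro mult_right_mono exp_moment_le) auto
  finally show ?thesis .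
qed

text \<open>The constant of \<open>finite_tail_bound\<close> is free of \<open>N\<close>,
  \<open>n\<close> and \<open>r\<close>. So \<open>N\<close> can tend to infinity for each fixed
  \<open>n\<close>, and the resulting bounds are summed against \<open>\<beta>\<close>. Extended
  nonnegative sums make sense for every outcome, convergent or not.\<close>

lemma tail_expectation_bound:
  fixes \<mu> \<beta> :: "nat \<Rightarrow> real"
  assumes \<mu>: "\<And>k. 0 \<le> \<mu> k" "summable \<mu>" and \<kappa>: "0 < \<kappa>" and g: "0 < g"
    and top: "\<And>k. k < g \<Longrightarrow> \<mu> k = \<kappa>" and gap: "\<And>k. g \<le> k \<Longrightarrow> \<mu> k / \<kappa> \<le> \<tau>" "\<tau> < 1"
    and \<beta>: "\<And>k. 0 \<le> \<beta> k" "summable \<beta>"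
  obtains B where "0 \<le> B" "\<And>r. 0 \<le> r \<Longrightarrow>
    (\<integral>\<^sup>+ \<omega>. (\<Sum>n. ennreal (if n < g then 0 else \<beta> n * norm (s n \<omega>))) *
       indicator {\<omega>. ennreal r < (\<Sum>k. ennreal (\<mu> k * (norm (s k \<omega>))\<^sup>2))} \<omega> \<partial>M) \<le>
    ennreal B * emeasure M {\<omega> \<in> space M. ennreal r < (\<Sum>k. ennreal (\<mu> k * (norm (s k \<omega>))\<^sup>2))}"
proof
  define T where "T = suminf \<mu> / \<kappa>"
  define A where "A = 2 / (1 - \<tau>) * exp ((T + 1) / ((1 - \<tau>) / 2))"
  have A0: "0 \<le> A" using gap by (simp add: A_def)
  define S where "S \<omega> = (\<Sum>k. ennreal (\<mu> k * (norm (s k \<omega>))\<^sup>2))" for \<omega>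
  define SN where "SN N \<omega> = (\<Sum>k<N. \<mu> k * (norm (s k \<omega>))\<^sup>2)" for N \<omega>
  have [measurable]: "S \<in> borel_measurable M" "SN N \<in> borel_measurable M" for N
    unfolding S_def SN_def by measurable
  have SN_mono: "SN N \<omega> \<le> SN N' \<omega>" if "N \<le> N'" for N N' \<omega>
    unfolding SN_def using \<mu> that by (intro sum_mono2) auto
  have SN_S: "ennreal (SN N \<omega>) = (\<Sum>k<N. ennreal (\<mu> k * (norm (s k \<omega>))\<^sup>2))" for N \<omega>
    unfolding SN_def using \<mu> by (intro sum_ennreal[symmetric]) auto
  have iff: "ennreal r < S \<omega> \<longleftrightarrow> (\<exists>N. r < SN N \<omega>)" if r: "0 \<le> r" for r \<omega>
  proof -
    have "S \<omega> = (SUP N. ennreal (SN N \<omega>))" by (simp add: S_def suminf_eq_SUP SN_S)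
    then show ?thesis using r by (simp add: less_SUP_iff ennreal_less_iff)
  qed
  show "0 \<le> A * suminf \<beta>" using A0 \<beta> by (simp add: suminf_nonneg)
  fix r :: real assume r: "0 \<le> r"
  define p where "p = emeasure M {\<omega> \<in> space M. ennreal r < S \<omega>}"
  have single: "(\<integral>\<^sup>+ \<omega>. ennreal (norm (s n \<omega>)) * indicator {\<omega>. ennreal r < S \<omega>} \<omega> \<partial>M) \<le> ennreal A * p" if n: "g \<le> n" for n
  proof -
    define E where "E N = {\<omega> \<in> space M. r < SN N \<omega>}" for N
    have E[measurable]: "E N \<in> sets M" for N unfolding E_def by measurable
    \<comment> \<open>Taking the weight as a density turns the limit over the increasing events
      \<open>E N\<close> into continuity from below.\<close>
    let ?D = "density M (\<lambda>\<omega>. ennreal (norm (s n \<omega>)))"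
    have D: "emeasure ?D X = (\<integral>\<^sup>+ \<omega>. ennreal (norm (s n \<omega>)) * indicator X \<omega> \<partial>M)" if "X \<in> sets M" for X
      using that by (intro emeasure_density) auto
    have "(\<integral>\<^sup>+ \<omega>. ennreal (norm (s n \<omega>)) * indicator {\<omega>. ennreal r < S \<omega>} \<omega> \<partial>M) = emeasure ?D (\<Union>N. E N)"
      by (subst D) (auto simp: E_def iff[OF r] indicator_def intro!: nn_integral_cong)
    also have "\<dots> = (SUP N. emeasure ?D (E N))"
      by (intro SUP_emeasure_incseq[symmetric]) (auto simp: E_def incseq_def intro: less_le_trans SN_mono)
    also have "\<dots> \<le> ennreal A * p"
    proof (rule SUP_least)
      fix N
      \<comment> \<open>The truncated sum has to include the index \<open>n\<close> itself.\<close>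
      define N' where "N' = max N (Suc n)"
      have "SN N \<omega> \<le> SN N' \<omega>" for \<omega> by (rule SN_mono) (simp add: N'_def)
      then have "emeasure ?D (E N) \<le> emeasure ?D (E N')"
        by (intro emeasure_mono) (auto simp: E_def intro: less_le_trans)
      also have "\<dots> = (\<integral>\<^sup>+ \<omega>. ennreal (norm (s n \<omega>)) * indicator {\<omega>. r < (\<Sum>k<N'. \<mu> k * (norm (s k \<omega>))\<^sup>2)} \<omega> \<partial>M)"
        by (subst D) (auto simp: E_def SN_def indicator_def intro!: nn_integral_cong)
      also have "\<dots> \<le> ennreal A * emeasure M {\<omega> \<in> space M. r < (\<Sum>k<g. \<mu> k * (norm (s k \<omega>))\<^sup>2)}"
        unfolding A_def
      proof (rule finite_tail_bound[OF \<mu>(1) \<kappa> g top gap])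
        have "(\<Sum>k\<in>{g..<N'}. \<mu> k) \<le> suminf \<mu>" using \<mu> by (intro sum_le_suminf) auto
        then show "(\<Sum>k\<in>{g..<N'}. \<mu> k / \<kappa>) \<le> T"
          using \<kappa> by (simp add: T_def divide_right_mono flip: sum_divide_distrib)
      qed (use n in \<open>auto simp: N'_def\<close>)
      \<comment> \<open>The top part is a partial sum of the nonnegative series, so its tail event
        is contained in the full one.\<close>
      also have "\<dots> \<le> ennreal A * p"
        unfolding p_def using iff[OF r] by (intro mult_left_mono emeasure_mono) (auto simp: SN_def)
      finally show "emeasure ?D (E N) \<le> ennreal A * p" .
    qed
    finally show ?thesis .
  qed
  have "(\<integral>\<^sup>+ \<omega>. (\<Sum>n. ennreal (if n < g then 0 else \<beta> n * norm (s n \<omega>))) * indicator {\<omega>. ennreal r < S \<omega>} \<omega> \<partial>M) =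
    (\<Sum>n. \<integral>\<^sup>+ \<omega>. ennreal (if n < g then 0 else \<beta> n * norm (s n \<omega>)) * indicator {\<omega>. ennreal r < S \<omega>} \<omega> \<partial>M)"
    by (subst nn_integral_suminf[symmetric]) (auto simp: ennreal_suminf_multc)
  also have "\<dots> \<le> (\<Sum>n. ennreal (\<beta> n) * (ennreal A * p))"
  proof (intro suminf_le)
    fix n
    show "(\<integral>\<^sup>+ \<omega>. ennreal (if n < g then 0 else \<beta> n * norm (s n \<omega>)) * indicator {\<omega>. ennreal r < S \<omega>} \<omega> \<partial>M) \<le> ennreal (\<beta> n) * (ennreal A * p)"
    proof (cases "n < g")
      case False
      then have "(\<integral>\<^sup>+ \<omega>. ennreal (if n < g then 0 else \<beta> n * norm (s n \<omega>)) * indicator {\<omega>. ennreal r < S \<omega>} \<omega> \<partial>M)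
        = ennreal (\<beta> n) * (\<integral>\<^sup>+ \<omega>. ennreal (norm (s n \<omega>)) * indicator {\<omega>. ennreal r < S \<omega>} \<omega> \<partial>M)"
        using \<beta> by (subst nn_integral_cmult[symmetric]) (auto simp: ennreal_mult mult.assoc)
      also have "\<dots> \<le> ennreal (\<beta> n) * (ennreal A * p)" using False by (intro mult_left_mono single) auto
      finally show ?thesis .
    qed simp
  qed auto
  also have "\<dots> = ennreal (suminf \<beta>) * (ennreal A * p)"
    using \<beta> by (simp add: ennreal_suminf_multc suminf_ennreal2)
  also have "\<dots> = ennreal (A * suminf \<beta>) * p"
    using A0 \<beta> by (simp add: ennreal_mult suminf_nonneg mult_ac)
  finally show "(\<integral>\<^sup>+ \<omega>. (\<Sum>n. ennreal (if n < g then 0 else \<beta> n * norm (s n \<omega>))) *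
       indicator {\<omega>. ennreal r < (\<Sum>k. ennreal (\<mu> k * (norm (s k \<omega>))\<^sup>2))} \<omega> \<partial>M) \<le>
    ennreal (A * suminf \<beta>) * emeasure M {\<omega> \<in> space M. ennreal r < (\<Sum>k. ennreal (\<mu> k * (norm (s k \<omega>))\<^sup>2))}"
    unfolding p_def S_def .
qed

text \<open>The term of index 0 alone exceeds \<open>r\<close> with positive probability; hence
  conditioning on the event is meaningful for every \<open>r \<ge> 0\<close>.\<close>

lemma tail_positive:
  assumes \<mu>: "\<And>k. 0 \<le> \<mu> k" "0 < \<mu> 0" and r: "0 \<le> r"
  shows "0 < emeasure M {\<omega> \<in> space M. ennreal r < (\<Sum>k. ennreal (\<mu> k * (norm (s k \<omega>))\<^sup>2))}"
proof -
  have "0 < ennreal (exp (- (r / \<mu> 0)))" by simp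
  also have "\<dots> = emeasure M {\<omega> \<in> space M. r / \<mu> 0 < (norm (s 0 \<omega>))\<^sup>2}"
    using \<mu> r by (intro std_complex_gaussian_tail[symmetric] gauss) auto
  also have "\<dots> \<le> emeasure M {\<omega> \<in> space M. ennreal r < (\<Sum>k. ennreal (\<mu> k * (norm (s k \<omega>))\<^sup>2))}"
  proof (intro emeasure_mono subsetI)
    fix \<omega> assume "\<omega> \<in> {\<omega> \<in> space M. r / \<mu> 0 < (norm (s 0 \<omega>))\<^sup>2}"
    then have \<omega>: "\<omega> \<in> space M" "r < \<mu> 0 * (norm (s 0 \<omega>))\<^sup>2" using \<mu> by (auto simp: divide_less_eq mult.commute)
    have "ennreal r < ennreal (\<mu> 0 * (norm (s 0 \<omega>))\<^sup>2)" using \<omega> r by (simp add: ennreal_less_iff)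
    also have "\<dots> = (\<Sum>k<Suc 0. ennreal (\<mu> k * (norm (s k \<omega>))\<^sup>2))" by simp
    also have "\<dots> \<le> (\<Sum>k. ennreal (\<mu> k * (norm (s k \<omega>))\<^sup>2))" by (intro sum_le_suminf) auto
    finally show "\<omega> \<in> {\<omega> \<in> space M. ennreal r < (\<Sum>k. ennreal (\<mu> k * (norm (s k \<omega>))\<^sup>2))}" using \<omega> by simp
  qed measurable
  finally show ?thesis .
qed

text \<open>The series has finite expectation: \<open>exp_moment_le\<close> with zero exponents
  bounds all first absolute moments by one constant.\<close>

lemma AE_summable_weighted:
  assumes \<beta>: "\<And>k. 0 \<le> \<beta> k" "summable \<beta>"
  shows "AE \<omega> in M. summable (\<lambda>n. \<beta> n * norm (s n \<omega>))"
proof -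
  define A where "A = 2 / (1 - 0) * exp ((0 + 1) / ((1 - 0) / 2 :: real))"
  have s1: "(\<integral>\<^sup>+ \<omega>. ennreal (norm (s n \<omega>)) \<partial>M) \<le> ennreal A" for n
    using exp_moment_le[of "{n}" n "\<lambda>_. 0" 0 0] by (simp add: A_def)
  have "(\<integral>\<^sup>+ \<omega>. (\<Sum>n. ennreal (\<beta> n * norm (s n \<omega>))) \<partial>M) = (\<Sum>n. \<integral>\<^sup>+ \<omega>. ennreal (\<beta> n) * ennreal (norm (s n \<omega>)) \<partial>M)"
    using \<beta> by (subst nn_integral_suminf[symmetric]) (auto simp: ennreal_mult)
  also have "\<dots> \<le> (\<Sum>n. ennreal (\<beta> n) * ennreal A)"
    by (intro suminf_le) (auto simp: nn_integral_cmult intro!: mult_left_mono s1)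
  also have "\<dots> = ennreal (suminf \<beta>) * ennreal A"
    using \<beta> by (simp add: ennreal_suminf_multc suminf_ennreal2)
  also have "\<dots> < \<infinity>" by (simp add: ennreal_mult_less_top)
  finally have "AE \<omega> in M. (\<Sum>n. ennreal (\<beta> n * norm (s n \<omega>))) \<noteq> \<infinity>"
    by (intro nn_integral_PInf_AE) auto
  then show ?thesis
    by eventually_elim (use \<beta> in \<open>auto intro!: summable_suminf_not_top\<close>)
qed

end

section \<open>The Karhunen-Loeve series\<close>

context smooth_kernel begin

text \<open>If no \<open>\<mu> n\<close> equalled \<open>\<kappa>\<close>, the spanning clause of
  \<open>eigensystem\<close> would write a nonzero eigenfunction as an empty sum. Conversely
  \<open>e 0\<close> is a nonzero eigenfunction, so maximality bounds
  \<open>\<mu> 0\<close>.\<close>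

lemma top_eigenvalue:
  assumes top: "is_largest_eigenvalue C \<kappa>" and \<kappa>: "0 < \<kappa>"
  shows "\<mu> 0 = \<kappa>"
proof (rule antisym)
  obtain f where f: "f \<in> eigenspace C \<kappa>" "\<not> (AE x in lebesgue01. f x = 0)"
    using top by (auto simp: is_largest_eigenvalue_def is_eigenvalue_def)
  have "\<exists>n. \<mu> n = \<kappa>"
  proof (rule ccontr)
    assume none: "\<not> ?thesis"
    obtain c where "AE x in lebesgue01. f x = (\<Sum>n | \<mu> n = \<kappa>. c n * e n x)"
      using eigen \<kappa> f(1) unfolding eigensystem_def by blast
    moreover have "{n. \<mu> n = \<kappa>} = {}" using none by auto
    ultimately show False using f(2) by simp
  qed
  then obtain n where "\<mu> n = \<kappa>" by blast
  then show "\<kappa> \<le> \<mu> 0" using mu_decseq by (auto simp: decseq_def)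
  then have \<mu>0: "0 < \<mu> 0" using \<kappa> by simp
  have "e 0 \<in> eigenspace C (\<mu> 0)"
    using e_L2[OF \<mu>0] e_cov_op[OF \<mu>0] by (auto simp: eigenspace_def intro!: AE_I2)
  moreover have "\<not> (AE x in lebesgue01. e 0 x = 0)"
  proof
    assume "AE x in lebesgue01. e 0 x = 0"
    then have "(LINT x|lebesgue01. (norm (e 0 x))\<^sup>2) = (LINT x|lebesgue01. 0)"
      using e_L2[OF \<mu>0] by (intro integral_cong_AE) (auto simp: L2_def)
    then show False using L2_norm_sq[OF e_L2[OF \<mu>0]] e_norm[OF \<mu>0] by simp
  qed
  ultimately have "is_eigenvalue C (\<mu> 0)" by (auto simp: is_eigenvalue_def)
  then show "\<mu> 0 \<le> \<kappa>" using top by (simp add: is_largest_eigenvalue_def)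
qed

text \<open>Monotonicity makes the top indices an initial segment and the limit 0 makes it finite,
  so the cardinality in \<open>perp_part\<close> is \<open>g\<close>. The strict gap at
  \<open>g\<close> is what keeps the exponential moments finite.\<close>

lemma top_multiplicity:
  assumes \<kappa>: "\<mu> 0 = \<kappa>" "0 < \<kappa>"
  obtains g where "0 < g" "{n. \<mu> n = \<kappa>} = {..<g}" "\<mu> g < \<kappa>"
proof
  define g where "g = (LEAST n. \<mu> n < \<kappa>)"
  have "\<exists>n. \<mu> n < \<kappa>"
    using order_tendstoD(2)[OF mu_tendsto \<kappa>(2)] by (meson eventually_sequentially order_refl)
  then show g: "\<mu> g < \<kappa>" unfolding g_def by (rule LeastI_ex)
  then show "0 < g" using \<kappa> by (cases "g = 0") auto
  show "{n. \<mu> n = \<kappa>} = {..<g}"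
  proof (intro equalityI subsetI)
    fix n assume "n \<in> {n. \<mu> n = \<kappa>}"
    then show "n \<in> {..<g}" using g mu_decseq by (auto simp: decseq_def) (meson not_le order.strict_trans1 order_less_irrefl)
  next
    fix n assume "n \<in> {..<g}"
    then have "\<kappa> \<le> \<mu> n" unfolding g_def using not_less_Least by force
    then show "n \<in> {n. \<mu> n = \<kappa>}" using mu_decseq \<kappa> by (auto simp: decseq_def intro: antisym)
  qed
qed

lemma continuous_on_KL_term: "continuous_on {0..1} (KL_term s \<mu> e n \<omega>)"
proof (cases "\<mu> n = 0")
  case False
  then have "0 < \<mu> n" using mu_nonneg[of n] by simp
  then show ?thesis unfolding KL_term_def by (intro continuous_intros continuous_on_e)
qed (simp add: KL_term_def[abs_def])

lemma KL_partial_sum_norm: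
  "(L2_norm (\<lambda>x. \<Sum>n<N. KL_term s \<mu> e n \<omega> x))\<^sup>2 = (\<Sum>n<N. \<mu> n * (norm (s n \<omega>))\<^sup>2)"
proof -
  \<comment> \<open>Where \<open>\<mu> n = 0\<close> the function \<open>e n\<close> is
    unconstrained; these terms vanish and must be dropped before Pythagoras applies.\<close>
  define I where "I = {n. n < N \<and> 0 < \<mu> n}"
  have \<mu>0: "\<mu> n = 0" if "n \<in> {..<N} - I" for n using that mu_nonneg[of n] by (auto simp: I_def)
  have sub: "I \<subseteq> {..<N}" by (auto simp: I_def)
  have eq: "(\<Sum>n<N. KL_term s \<mu> e n \<omega> x) = (\<Sum>n\<in>I. (s n \<omega> * of_real (sqrt (\<mu> n))) * e n x)" for x
    using sub \<mu>0 unfolding KL_term_def by (intro sum.mono_neutral_right) auto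
  have "(L2_norm (\<lambda>x. \<Sum>n<N. KL_term s \<mu> e n \<omega> x))\<^sup>2 = (\<Sum>n\<in>I. (norm (s n \<omega> * of_real (sqrt (\<mu> n))))\<^sup>2)"
    unfolding eq by (rule pythagoras, rule e_orthonormal) (auto simp: I_def)
  also have "\<dots> = (\<Sum>n\<in>I. \<mu> n * (norm (s n \<omega>))\<^sup>2)"
    using mu_nonneg by (intro sum.cong) (auto simp: norm_mult power_mult_distrib)
  also have "\<dots> = (\<Sum>n<N. \<mu> n * (norm (s n \<omega>))\<^sup>2)"
    using sub \<mu>0 by (intro sum.mono_neutral_left) auto
  finally show ?thesis .
qed

section \<open>Pathwise convergence for a fixed outcome\<close>

context
  fixes s :: "nat \<Rightarrow> 'a \<Rightarrow> complex" and \<omega> :: 'a and \<beta> :: "nat \<Rightarrow> real" and \<phi> :: "real \<Rightarrow> complex"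
  assumes \<beta>: "\<And>n x. x \<in> {0..1} \<Longrightarrow> sqrt (\<mu> n) * norm (e n x) \<le> \<beta> n"
    and summable: "summable (\<lambda>n. \<beta> n * norm (s n \<omega>))"
    and KL: "\<And>x. x \<in> {0..1} \<Longrightarrow> \<phi> x = (\<Sum>n. KL_term s \<mu> e n \<omega> x)"
begin

lemma KL_term_le: "x \<in> {0..1} \<Longrightarrow> norm (KL_term s \<mu> e n \<omega> x) \<le> \<beta> n * norm (s n \<omega>)"
  using mult_right_mono[OF \<beta>[of x n] norm_ge_zero[of "s n \<omega>"]] mu_nonneg[of n]
  by (simp add: KL_term_def norm_mult mult_ac)

lemma KL_term_summable: "x \<in> {0..1} \<Longrightarrow> summable (\<lambda>n. KL_term s \<mu> e n \<omega> x)"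
  by (rule summable_comparison_test'[OF summable]) (rule KL_term_le)

lemma KL_uniform_limit: "uniform_limit {0..1} (\<lambda>N x. \<Sum>n<N. KL_term s \<mu> e n \<omega> x) \<phi> sequentially"
proof -
  have "uniform_limit {0..1} (\<lambda>N x. \<Sum>n<N. KL_term s \<mu> e n \<omega> x) (\<lambda>x. \<Sum>n. KL_term s \<mu> e n \<omega> x) sequentially"
    using KL_term_le summable by (rule Weierstrass_m_test)
  then show ?thesis by (rule uniform_limit_cong'[THEN iffD1, rotated -1]) (auto simp: KL)
qed

lemma KL_continuous: "continuous_on {0..1} \<phi>"
  by (rule uniform_limit_theorem[OF _ KL_uniform_limit])
    (auto intro!: always_eventually continuous_intros continuous_on_KL_term)

text \<open>Parseval for the limit: the partial sums have explicit norms and the common bound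
  \<open>b\<close>, so dominated convergence carries the norms over.\<close>

lemma KL_norm: "(\<lambda>n. \<mu> n * (norm (s n \<omega>))\<^sup>2) sums (L2_norm \<phi>)\<^sup>2"
proof -
  interpret finite_measure lebesgue01 by (rule finite_measure_lebesgue_on) auto
  define p where "p N x = (\<Sum>n<N. KL_term s \<mu> e n \<omega> x)" for N x
  define b where "b = (\<Sum>n. \<beta> n * norm (s n \<omega>))"
  have b: "norm (p N x) \<le> b" if "x \<in> {0..1}" for N x
  proof -
    have nn: "0 \<le> \<beta> n * norm (s n \<omega>)" for n using KL_term_le[OF that, of n] norm_ge_zero order_trans by blast
    have "norm (p N x) \<le> (\<Sum>n<N. \<beta> n * norm (s n \<omega>))"
      unfolding p_def using KL_term_le[OF that] by (intro sum_norm_le)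
    also have "\<dots> \<le> b" unfolding b_def using nn summable by (intro sum_le_suminf) auto
    finally show ?thesis .
  qed
  have pm: "p N \<in> borel_measurable lebesgue01" for N
    unfolding p_def by (intro continuous_imp_measurable_on_sets_lebesgue continuous_intros continuous_on_KL_term) auto
  have \<phi>m: "\<phi> \<in> borel_measurable lebesgue01"
    by (intro continuous_imp_measurable_on_sets_lebesgue KL_continuous) auto
  have lim: "(\<lambda>N. p N x) \<longlonglongrightarrow> \<phi> x" if "x \<in> {0..1}" for x
    using KL_uniform_limit that unfolding p_def by (rule tendsto_uniform_limitI)
  have \<phi>b: "norm (\<phi> x) \<le> b" if "x \<in> {0..1}" for x
    by (rule tendsto_upperbound[OF tendsto_norm[OF lim[OF that]]]) (use b that in auto)
  have "(\<lambda>N. LINT x|lebesgue01. (norm (p N x))\<^sup>2) \<longlonglongrightarrow> (LINT x|lebesgue01. (norm (\<phi> x))\<^sup>2)"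
  proof (rule integral_dominated_convergence[where w = "\<lambda>_. b\<^sup>2"])
    show "(\<lambda>x. (norm (\<phi> x))\<^sup>2) \<in> borel_measurable lebesgue01" "\<And>N. (\<lambda>x. (norm (p N x))\<^sup>2) \<in> borel_measurable lebesgue01"
      using pm \<phi>m by measurable
    show "AE x in lebesgue01. (\<lambda>N. (norm (p N x))\<^sup>2) \<longlonglongrightarrow> (norm (\<phi> x))\<^sup>2"
      using lim by (intro AE_I2 tendsto_intros) auto
    show "AE x in lebesgue01. norm ((norm (p N x))\<^sup>2) \<le> b\<^sup>2" for N
      using b by (intro AE_I2) (auto intro!: power_mono)
  qed auto
  moreover have "L2 (p N)" "L2 \<phi>" for N using L2_bounded pm \<phi>m b \<phi>b by metis+
  ultimately have "(\<lambda>N. (L2_norm (p N))\<^sup>2) \<longlonglongrightarrow> (L2_norm \<phi>)\<^sup>2" by (simp add: L2_norm_sq)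
  then show ?thesis by (simp add: sums_def p_def[abs_def] KL_partial_sum_norm)
qed

lemma KL_tail_le:
  assumes "x \<in> {0..1}"
  shows "norm (\<phi> x - (\<Sum>n<g. KL_term s \<mu> e n \<omega> x)) \<le> (\<Sum>n. if n < g then 0 else \<beta> n * norm (s n \<omega>))"
proof -
  let ?f = "\<lambda>n. if n < g then 0 else \<beta> n * norm (s n \<omega>)"
  have sf: "summable ?f"
    by (rule summable_cong[THEN iffD2, OF _ summable]) (auto intro: eventually_sequentiallyI[of g])
  have "\<phi> x - (\<Sum>n<g. KL_term s \<mu> e n \<omega> x) = (\<Sum>n. KL_term s \<mu> e (n + g) \<omega> x)"
    using suminf_split_initial_segment[OF KL_term_summable[OF assms], of g] KL[OF assms] by simp
  also have "norm \<dots> \<le> (\<Sum>n. \<beta> (n + g) * norm (s (n + g) \<omega>))"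
    using summable by (intro norm_suminf_le KL_term_le assms) (simp add: summable_iff_shift[of "\<lambda>n. \<beta> n * norm (s n \<omega>)"])
  also have "\<dots> = (\<Sum>n. ?f n)"
    using suminf_split_initial_segment[OF sf, of g] by simp
  finally show ?thesis .
qed

end

end

section \<open>Measurability of the norm in the outcome\<close>

lemma L2_norm_measurable:
  fixes f :: "'a \<Rightarrow> real \<Rightarrow> complex"
  assumes "(\<lambda>(\<omega>, x). f \<omega> x) \<in> borel_measurable (M \<Otimes>\<^sub>M lebesgue01)"
  shows "(\<lambda>\<omega>. L2_norm (f \<omega>)) \<in> borel_measurable M"
proof -
  interpret finite_measure lebesgue01 by (rule finite_measure_lebesgue_on) auto
  have "(\<lambda>(\<omega>, x). (norm (f \<omega> x))\<^sup>2) \<in> borel_measurable (M \<Otimes>\<^sub>M lebesgue01)"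
    using assms by (simp add: case_prod_beta')
  then have "(\<lambda>\<omega>. LINT x|lebesgue01. (norm (f \<omega> x))\<^sup>2) \<in> borel_measurable M"
    by (rule borel_measurable_lebesgue_integral)
  then show ?thesis unfolding L2_norm_def by measurable
qed

text \<open>Measurability of the field at each single point would not make its L2 norm measurable;
  the series supplies joint measurability, needed for the conditioning event.\<close>

lemma (in smooth_kernel) KL_series_jointly_measurable:
  assumes s: "\<And>n. s n \<in> borel_measurable M"
  shows "(\<lambda>(\<omega>, x). \<Sum>n. KL_term s \<mu> e n \<omega> x) \<in> borel_measurable (M \<Otimes>\<^sub>M lebesgue01)"
proof -
  have "(\<lambda>p. KL_term s \<mu> e n (fst p) (snd p)) \<in> borel_measurable (M \<Otimes>\<^sub>M lebesgue01)" for n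
  proof (cases "\<mu> n = 0")
    case False
    then have "0 < \<mu> n" using mu_nonneg[of n] by simp
    then have "e n \<in> borel_measurable lebesgue01" using e_L2 by (simp add: L2_def)
    then show ?thesis unfolding KL_term_def
      using s by (intro borel_measurable_times measurable_compose[OF measurable_fst s] measurable_compose[OF measurable_snd]) auto
  qed (simp add: KL_term_def)
  then show ?thesis unfolding case_prod_beta' by (rule borel_measurable_suminf)
qed

theorem proposition3:
  fixes M :: "'a measure"
    and C :: "real \<Rightarrow> real \<Rightarrow> complex"
    and \<phi> :: "'a \<Rightarrow> real \<Rightarrow> complex"
    and s :: "nat \<Rightarrow> 'a \<Rightarrow> complex"
    and \<mu> :: "nat \<Rightarrow> real"
    and e :: "nat \<Rightarrow> real \<Rightarrow> complex"
    and \<kappa>1 :: real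
  assumes prob: "prob_space M"
    and field: "complex_gaussian_field M \<phi>"
    and mean: "\<And>x. x \<in> {0..1} \<Longrightarrow> (LINT \<omega>|M. \<phi> \<omega> x) = 0"
    and pseudo_cov: "\<And>x y. x \<in> {0..1} \<Longrightarrow> y \<in> {0..1} \<Longrightarrow> (LINT \<omega>|M. \<phi> \<omega> x * \<phi> \<omega> y) = 0"
    and cov: "\<And>x y. x \<in> {0..1} \<Longrightarrow> y \<in> {0..1} \<Longrightarrow> (LINT \<omega>|M. \<phi> \<omega> x * cnj (\<phi> \<omega> y)) = C x y"
    and eigen: "eigensystem C \<mu> e"
    and top: "is_largest_eigenvalue C \<kappa>1" "0 < \<kappa>1"
    and s_indep: "prob_space.indep_vars M (\<lambda>_. borel) s UNIV"
    and s_gauss: "\<And>n. std_complex_gaussian M (s n)"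
    and KL: "\<And>\<omega> x. \<omega> \<in> space M \<Longrightarrow> x \<in> {0..1} \<Longrightarrow> \<phi> \<omega> x = (\<Sum>n. KL_term s \<mu> e n \<omega> x)"
    and smooth: "C4_in_first_variable C"
  shows "(AE \<omega> in M. continuous_on {0..1} (\<phi> \<omega>)) \<and>
    (\<forall>x\<in>{0..1}. summable (\<lambda>n. sqrt (\<mu> n) * (norm (e n x))\<^sup>2)) \<and>
    bounded ((\<lambda>x. \<Sum>n. sqrt (\<mu> n) * (norm (e n x))\<^sup>2) ` {0..1}) \<and>
    ((\<lambda>r. expectation_given M
            (\<lambda>\<omega>. sup_norm (\<lambda>x. perp_part s \<mu> e \<kappa>1 \<phi> \<omega> x / complex_of_real (L2_norm (\<phi> \<omega>))))
            (\<lambda>\<omega>. (L2_norm (\<phi> \<omega>))\<^sup>2 > r)) \<longlongrightarrow> 0) at_top"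
proof -
  obtain D where D_0: "\<And>x y. x \<in> {0..1} \<Longrightarrow> y \<in> {0..1} \<Longrightarrow> D 0 x y = C x y"
    and D_Suc: "\<And>k x y. k < 4 \<Longrightarrow> x \<in> {0..1} \<Longrightarrow> y \<in> {0..1} \<Longrightarrow>
       ((\<lambda>t. D k t y) has_vector_derivative D (Suc k) x y) (at x within {0..1})"
    and D_4: "continuous_on ({0..1} \<times> {0..1}) (\<lambda>(x, y). D 4 x y)"
    using smooth unfolding C4_in_first_variable_def by blast
  have "bounded ((\<lambda>(x, y). D 4 x y) ` ({0..1} \<times> {0..1}))"
    by (intro compact_imp_bounded compact_continuous_image D_4 compact_Times) auto
  then obtain K where K: "\<And>x y. x \<in> {0..1} \<Longrightarrow> y \<in> {0..1} \<Longrightarrow> norm (D 4 x y) \<le> K"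
    by (force simp: bounded_iff)
  interpret smooth_kernel C D \<mu> e K
  proof
    fix x y :: real assume xy: "x \<in> {0..1}" "y \<in> {0..1}"
    have "cnj (C y x) = (LINT \<omega>|M. cnj (\<phi> \<omega> y * cnj (\<phi> \<omega> x)))"
      unfolding cov[OF xy(2) xy(1), symmetric] by (rule Bochner_Integration.integral_cnj[symmetric])
    also have "\<dots> = C x y" unfolding cov[OF xy, symmetric] by (simp add: mult.commute)
    finally show "C x y = cnj (C y x)" by simp
  qed (fact D_0 D_Suc K eigen)+
  interpret prob_space M by (rule prob)
  interpret complex_gaussian_sequence M s by unfold_locales (fact s_indep s_gauss)+
  have \<kappa>: "\<mu> 0 = \<kappa>1" using top by (rule top_eigenvalue)
  obtain g where g: "0 < g" "{n. \<mu> n = \<kappa>1} = {..<g}" "\<mu> g < \<kappa>1"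
    using top_multiplicity[OF \<kappa> top(2)] by metis
  obtain \<beta> \<gamma> where sum: "summable \<beta>" "summable \<gamma>" and \<beta>0: "\<And>n. 0 \<le> \<beta> n"
    and \<beta>: "\<And>n x. x \<in> {0..1} \<Longrightarrow> sqrt (\<mu> n) * norm (e n x) \<le> \<beta> n"
    and \<gamma>: "\<And>n x. x \<in> {0..1} \<Longrightarrow> sqrt (\<mu> n) * (norm (e n x))\<^sup>2 \<le> \<gamma> n"
    using weighted_sup_summable by metis
  \<comment> \<open>\<open>S\<close> stands for the squared norm and \<open>Y\<close> for a bound on
    the sup norm of the perpendicular part. Both are measurable by construction, and the link to the
    field holds almost surely.\<close>
  define S where "S \<omega> = (\<Sum>k. ennreal (\<mu> k * (norm (s k \<omega>))\<^sup>2))" for \<omega>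
  define Y where "Y \<omega> = (\<Sum>n. ennreal (if n < g then 0 else \<beta> n * norm (s n \<omega>)))" for \<omega>
  have [measurable]: "S \<in> borel_measurable M" "Y \<in> borel_measurable M"
    unfolding S_def Y_def by measurable
  have top_k: "\<mu> k = \<kappa>1" if "k < g" for k using g(2) that by auto
  have gap_k: "\<mu> k / \<kappa>1 \<le> \<mu> g / \<kappa>1" if "g \<le> k" for k
    using mu_decseq that top(2) by (intro divide_right_mono) (auto simp: decseq_def)
  have gap_g: "\<mu> g / \<kappa>1 < 1" using g(3) top(2) by simp
  obtain B where B: "0 \<le> B" "\<And>r. 0 \<le> r \<Longrightarrow> (\<integral>\<^sup>+ \<omega>. Y \<omega> * indicator {\<omega>. ennreal r < S \<omega>} \<omega> \<partial>M) \<le>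
      ennreal B * emeasure M {\<omega> \<in> space M. ennreal r < S \<omega>}"
    using tail_expectation_bound[OF mu_nonneg summable_mu top(2) g(1) top_k gap_k gap_g \<beta>0 sum(1), folded S_def Y_def]
    by blast
  have good: "AE \<omega> in M. \<omega> \<in> space M \<and> summable (\<lambda>n. \<beta> n * norm (s n \<omega>))"
    using AE_summable_weighted[OF \<beta>0 sum(1)] AE_space by eventually_elim simp

  have "AE \<omega> in M. continuous_on {0..1} (\<phi> \<omega>)"
    using good by eventually_elim (rule KL_continuous[OF \<beta>], auto simp: KL)
  moreover have sq: "summable (\<lambda>n. sqrt (\<mu> n) * (norm (e n x))\<^sup>2)" if "x \<in> {0..1}" for x
    using sum(2) by (rule summable_comparison_test') (use \<gamma>[OF that] mu_nonneg in auto)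
  moreover have "bounded ((\<lambda>x. \<Sum>n. sqrt (\<mu> n) * (norm (e n x))\<^sup>2) ` {0..1})"
    unfolding bounded_iff
  proof (intro exI ballI, elim imageE, hypsubst)
    fix x :: real assume x: "x \<in> {0..1}"
    have "0 \<le> (\<Sum>n. sqrt (\<mu> n) * (norm (e n x))\<^sup>2)"
      using sq[OF x] mu_nonneg by (intro suminf_nonneg) auto
    moreover have "(\<Sum>n. sqrt (\<mu> n) * (norm (e n x))\<^sup>2) \<le> suminf \<gamma>"
      using sq[OF x] sum(2) \<gamma>[OF x] by (intro suminf_le) auto
    ultimately show "norm (\<Sum>n. sqrt (\<mu> n) * (norm (e n x))\<^sup>2) \<le> suminf \<gamma>" by simp
  qed
  moreover have "((\<lambda>r. expectation_given M
            (\<lambda>\<omega>. sup_norm (\<lambda>x. perp_part s \<mu> e \<kappa>1 \<phi> \<omega> x / complex_of_real (L2_norm (\<phi> \<omega>))))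
            (\<lambda>\<omega>. (L2_norm (\<phi> \<omega>))\<^sup>2 > r)) \<longlongrightarrow> 0) at_top"
  \<comment> \<open>The factor \<open>1 / sqrt r\<close> comes from dividing by a norm above
    \<open>sqrt r\<close>; the conditional expectation of \<open>Y\<close> stays below
    \<open>B\<close>.\<close>
  proof (rule tendsto_sandwich[where f = "\<lambda>_. 0" and h = "\<lambda>r. ennreal (B / sqrt r)"])
    have norm_S: "AE \<omega> in M. ennreal ((L2_norm (\<phi> \<omega>))\<^sup>2) = S \<omega>"
      using good
    proof eventually_elim
      case (elim \<omega>)
      then have "(\<lambda>n. \<mu> n * (norm (s n \<omega>))\<^sup>2) sums (L2_norm (\<phi> \<omega>))\<^sup>2"
        by (intro KL_norm[OF \<beta>]) (auto simp: KL)
      then show ?case using mu_nonneg unfolding S_def by (subst suminf_ennreal2) (auto simp: sums_iff)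
    qed
    have perp_Y: "AE \<omega> in M. \<forall>x\<in>{0..1}. ennreal (norm (perp_part s \<mu> e \<kappa>1 \<phi> \<omega> x)) \<le> Y \<omega>"
      using good
    proof eventually_elim
      case (elim \<omega>)
      have "summable (\<lambda>n. if n < g then 0 else \<beta> n * norm (s n \<omega>))"
        by (rule summable_cong[THEN iffD2, OF _ conjunct2[OF elim]]) (auto intro: eventually_sequentiallyI[of g])
      then have Y: "Y \<omega> = ennreal (\<Sum>n. if n < g then 0 else \<beta> n * norm (s n \<omega>))"
        unfolding Y_def using \<beta>0 by (intro suminf_ennreal2) auto
      show ?case unfolding Y perp_part_def g(2) card_lessThan
        using elim by (intro ballI ennreal_leI KL_tail_le[OF \<beta>]) (auto simp: KL)
    qed
    have L2m: "(\<lambda>\<omega>. L2_norm (\<phi> \<omega>)) \<in> borel_measurable M"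
    proof (rule L2_norm_measurable)
      show "(\<lambda>(\<omega>, x). \<phi> \<omega> x) \<in> borel_measurable (M \<Otimes>\<^sub>M lebesgue01)"
        using KL_series_jointly_measurable[of s M, OF s_measurable]
        by (rule measurable_cong[THEN iffD1, rotated]) (auto simp: space_pair_measure KL)
    qed
    have bound: "expectation_given M
            (\<lambda>\<omega>. sup_norm (\<lambda>x. perp_part s \<mu> e \<kappa>1 \<phi> \<omega> x / complex_of_real (L2_norm (\<phi> \<omega>))))
            (\<lambda>\<omega>. (L2_norm (\<phi> \<omega>))\<^sup>2 > r) \<le> ennreal (B / sqrt r)" if r: "0 < r" for r
    proof -
      define A where "A = {\<omega> \<in> space M. (L2_norm (\<phi> \<omega>))\<^sup>2 > r}"
      define p where "p = emeasure M {\<omega> \<in> space M. ennreal r < S \<omega>}"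
      have A[measurable]: "A \<in> sets M" unfolding A_def using L2m by measurable
      have AS: "AE \<omega> in M. \<omega> \<in> A \<longleftrightarrow> ennreal r < S \<omega>"
        using norm_S AE_space
      proof eventually_elim
        case (elim \<omega>)
        show ?case using elim(2) r unfolding elim(1)[symmetric] by (simp add: A_def ennreal_less_iff)
      qed
      have pA: "emeasure M A = p"
        unfolding p_def
      proof (rule emeasure_eq_AE)
        show "AE \<omega> in M. \<omega> \<in> A \<longleftrightarrow> \<omega> \<in> {\<omega> \<in> space M. ennreal r < S \<omega>}"
          using AS AE_space by eventually_elim simp
      qed measurable
      \<comment> \<open>A nonzero and finite \<open>p\<close> is what makes the extended quotient
        \<open>p / p\<close> equal to 1 below.\<close>
      have "0 < p" unfolding p_def S_def
        by (rule tail_positive[OF mu_nonneg]) (use \<kappa> top(2) r in simp_all)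
      then have p0: "p \<noteq> 0" "p \<noteq> \<top>" by (simp_all add: p_def)
      \<comment> \<open>A supremum over uncountably many points is not known to be measurable in
        \<open>\<omega>\<close>, so it is replaced by \<open>Y\<close> almost everywhere before any
        rule that needs measurability.\<close>
      have "AE \<omega> in uniform_measure M A. sup_norm (\<lambda>x. perp_part s \<mu> e \<kappa>1 \<phi> \<omega> x / complex_of_real (L2_norm (\<phi> \<omega>)))
          \<le> ennreal (1 / sqrt r) * Y \<omega>"
      proof (rule AE_uniform_measureI[OF A])
        show "AE \<omega> in M. \<omega> \<in> A \<longrightarrow> sup_norm (\<lambda>x. perp_part s \<mu> e \<kappa>1 \<phi> \<omega> x / complex_of_real (L2_norm (\<phi> \<omega>)))
          \<le> ennreal (1 / sqrt r) * Y \<omega>"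
          using perp_Y
        proof (eventually_elim, intro impI)
          fix \<omega> assume le: "\<forall>x\<in>{0..1}. ennreal (norm (perp_part s \<mu> e \<kappa>1 \<phi> \<omega> x)) \<le> Y \<omega>" and "\<omega> \<in> A"
          then have "r < (L2_norm (\<phi> \<omega>))\<^sup>2" by (simp add: A_def)
          moreover have "0 \<le> L2_norm (\<phi> \<omega>)" by (simp add: L2_norm_def integral_nonneg_AE)
          ultimately have L: "sqrt r \<le> L2_norm (\<phi> \<omega>)" using r by (simp add: real_le_lsqrt)
          show "sup_norm (\<lambda>x. perp_part s \<mu> e \<kappa>1 \<phi> \<omega> x / complex_of_real (L2_norm (\<phi> \<omega>))) \<le> ennreal (1 / sqrt r) * Y \<omega>"
            unfolding sup_norm_def
          proof (rule SUP_least)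
            fix x :: real assume x: "x \<in> {0..1}"
            have "norm (perp_part s \<mu> e \<kappa>1 \<phi> \<omega> x / complex_of_real (L2_norm (\<phi> \<omega>))) =
                norm (perp_part s \<mu> e \<kappa>1 \<phi> \<omega> x) / \<bar>L2_norm (\<phi> \<omega>)\<bar>" by (simp add: norm_divide)
            also have "\<dots> \<le> norm (perp_part s \<mu> e \<kappa>1 \<phi> \<omega> x) / sqrt r"
              using L r less_le_trans[OF real_sqrt_gt_zero[OF r] L] by (intro divide_left_mono) auto
            finally have "ennreal (norm (perp_part s \<mu> e \<kappa>1 \<phi> \<omega> x / complex_of_real (L2_norm (\<phi> \<omega>)))) \<le>
                ennreal (1 / sqrt r) * ennreal (norm (perp_part s \<mu> e \<kappa>1 \<phi> \<omega> x))"
              using r by (simp add: ennreal_leI flip: ennreal_mult)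
            also have "\<dots> \<le> ennreal (1 / sqrt r) * Y \<omega>" using le x by (intro mult_left_mono) auto
            finally show "ennreal (norm (perp_part s \<mu> e \<kappa>1 \<phi> \<omega> x / complex_of_real (L2_norm (\<phi> \<omega>)))) \<le>
                ennreal (1 / sqrt r) * Y \<omega>" .
          qed
        qed
      qed
      then have "expectation_given M
            (\<lambda>\<omega>. sup_norm (\<lambda>x. perp_part s \<mu> e \<kappa>1 \<phi> \<omega> x / complex_of_real (L2_norm (\<phi> \<omega>))))
            (\<lambda>\<omega>. (L2_norm (\<phi> \<omega>))\<^sup>2 > r) \<le> (\<integral>\<^sup>+ \<omega>. ennreal (1 / sqrt r) * Y \<omega> \<partial>uniform_measure M A)"
        unfolding expectation_given_def A_def[symmetric] by (rule nn_integral_mono_AE)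
      also have "\<dots> = (\<integral>\<^sup>+ \<omega>. ennreal (1 / sqrt r) * (Y \<omega> * indicator {\<omega>. ennreal r < S \<omega>} \<omega>) \<partial>M) / p"
      proof -
        have "(\<integral>\<^sup>+ \<omega>. ennreal (1 / sqrt r) * Y \<omega> * indicator A \<omega> \<partial>M) =
          (\<integral>\<^sup>+ \<omega>. ennreal (1 / sqrt r) * (Y \<omega> * indicator {\<omega>. ennreal r < S \<omega>} \<omega>) \<partial>M)"
          by (rule nn_integral_cong_AE) (use AS in \<open>eventually_elim, auto simp: indicator_def\<close>)
        then show ?thesis by (subst nn_integral_uniform_measure) (auto simp: pA)
      qed
      also have "(\<integral>\<^sup>+ \<omega>. ennreal (1 / sqrt r) * (Y \<omega> * indicator {\<omega>. ennreal r < S \<omega>} \<omega>) \<partial>M) =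
          ennreal (1 / sqrt r) * (\<integral>\<^sup>+ \<omega>. Y \<omega> * indicator {\<omega>. ennreal r < S \<omega>} \<omega> \<partial>M)"
        by (rule nn_integral_cmult) measurable
      also have "\<dots> / p \<le> ennreal (1 / sqrt r) * (ennreal B * p) / p"
        unfolding p_def using B(2)[of r] r by (intro divide_right_mono_ennreal mult_left_mono) auto
      also have "\<dots> = ennreal (1 / sqrt r) * ennreal B * (p / p)"
        by (simp add: ennreal_times_divide mult.assoc)
      also have "\<dots> = ennreal (B / sqrt r)"
        using p0 B(1) r by (simp add: ennreal_divide_self top.not_eq_extremum zero_less_iff_neq_zero flip: ennreal_mult)
      finally show ?thesis .
    qed
    show "\<forall>\<^sub>F r in at_top. expectation_given M
            (\<lambda>\<omega>. sup_norm (\<lambda>x. perp_part s \<mu> e \<kappa>1 \<phi> \<omega> x / complex_of_real (L2_norm (\<phi> \<omega>))))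
            (\<lambda>\<omega>. (L2_norm (\<phi> \<omega>))\<^sup>2 > r) \<le> ennreal (B / sqrt r)"
      using eventually_gt_at_top[of 0] by eventually_elim (rule bound)
    have "((\<lambda>r. B / sqrt r) \<longlongrightarrow> 0) at_top"
      by (rule real_tendsto_divide_at_top[OF tendsto_const sqrt_at_top])
    then show "((\<lambda>r. ennreal (B / sqrt r)) \<longlongrightarrow> 0) at_top"
      using tendsto_ennrealI by fastforce
  qed auto
  ultimately show ?thesis by blast
qed

end
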